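(* Let $\rho\in L^\infty(\Omega)\setminus\{0\}$ be a weight that does not satisfy u.c.p. Then there exist $\tilde\rho\in L^\infty(\Omega)\setminus\{0\}$ such that either $\rho\le\tilde\rho$ a.e. in $\Omega$ or $\rho\ge\tilde\rho$ a.e. in $\Omega$, with $\rho\not\equiv\tilde\rho$, and $k\in\mathbb{Z}\setminus\{0\}$ such that $\lambda_k(\rho)=\lambda_k(\tilde\rho)$ (both eigenvalues existing).
   Context: $\Omega\subset\mathbb{R}^N$ is a bounded domain with Lipschitz continuous boundary. The kernel $K:\mathbb{R}^N\setminus\{0\}\to(0,+\infty)$ satisfies: (1) $mK\in L^1(\mathbb{R}^N)$, where $m(x)=\min\{|x|^2,1\}$; (2) $K(x)\ge\alpha|x|^{-(N+2s)}$ for all $x\in\mathbb{R}^N\setminus\{0\}$, for some $\alpha>0$ and $s\in(0,1)$ with $N>2s$; (3) $K(-x)=K(x)$ for all $x\in\mathbb{R}^N\setminus\{0\}$. Set $[u]_K^2=\int_{\mathbb{R}^{2N}}(u(x)-u(y))^2K(x-y)\,dx\,dy$ and $X_K(\Omega)=\{u\in L^2(\mathbb{R}^N):[u]_K<\infty,\ u=0\text{ a.e. in }\mathbb{R}^N\setminus\Omega\}$, a Hilbert space with scalar product $\langle u,v\rangle=\int_{\mathbb{R}^{2N}}(u(x)-u(y))(v(x)-v(y))K(x-y)\,dx\,dy$ and norm $\|u\|=[u]_K$. For a weight $\rho\in L^\infty(\Omega)$, the weighted eigenvalue problem is $L_Ku=\lambda\rho(x)u$ in $\Omega$, $u=0$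 in $\mathbb{R}^N\setminus\Omega$, where $L_Ku(x)=\mathrm{P.V.}\int_{\mathbb{R}^N}(u(x)-u(y))K(x-y)\,dy$; it is understood weakly: $\lambda\in\mathbb{R}$ is an eigenvalue with eigenfunction $u\in X_K(\Omega)\setminus\{0\}$ if $\langle u,v\rangle=\lambda\int_\Omega\rho(x)uv\,dx$ for all $v\in X_K(\Omega)$. The set of all eigenvalues is denoted $\sigma(\rho)$. For each integer $k\ge 0$, $\mathcal{F}_k$ is the family of all $k$-dimensional linear subspaces of $X_K(\Omega)$. If $\rho^+\not\equiv0$, the positive eigenvalues form a sequence $0<\lambda_1(\rho)<\lambda_2(\rho)\le\ldots\to\infty$ given, for $k\ge1$, by $$\lambda_k^{-1}(\rho)=\sup_{F\in\mathcal{F}_k}\inf_{u\in F,\|u\|=1}\int_\Omega\rho u^2\,dx=\inf_{F\in\mathcal{F}_{k-1}}\sup_{u\in F^\perp,\|u\|=1}\int_\Omega\rho u^2\,dx.$$ If $\rho^-\not\equiv0$, the negative eigenvalues form a sequence $0>\lambda_{-1}(\rho)>\lambda_{-2}(\rho)\ge\ldots\to-\infty$ given, for $k\ge1$, by $$\lambda_{-k}^{-1}(\rho)=\inf_{F\in\mathcal{F}_k}\sup_{u\in F,\|u\|=1}\int_\Omega\rho u^2\,dx=\sup_{F\in\mathcal{F}_{k-1}}\inf_{u\in F^\perp,\|u\|=1}\int_\Omega\rho u^2\,dx.$$ Here $\rho^\pm$ are the positive and negative parts of $\rho$, and $F^\perp$ is the orthogonal complement in $X_K(\Omega)$. For $k>0$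 the eigenvalue $\lambda_k(\rho)$ exists iff $\rho^+\not\equiv0$; for $k<0$ it exists iff $\rho^-\not\equiv0$. A weight $\rho\in L^\infty(\Omega)\setminus\{0\}$ satisfies u.c.p. (unique continuation property) if for every eigenfunction $u\in X_K(\Omega)$ of the problem with weight $\rho$ (for any $\lambda\in\sigma(\rho)$), the set $\{x\in\Omega:u(x)=0\}$ has Lebesgue measure zero. *)

theory Defs
  imports "HOL-Analysis.Analysis"
begin

text \<open>
  Elements of \<open>L\<^sup>2\<close>, \<open>L\<^sup>\<infinity>\<close> and \<open>X\<^sub>K\<close> are represented by functions; every definition below
  respects equality almost everywhere, which is the equality of the quotient spaces.
  Measurability is Lebesgue (not Borel) measurability throughout; in particular double
  integrals use the completed Lebesgue measure of \<open>\<real>\<^sup>N \<times> \<real>\<^sup>N\<close>.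
\<close>

text \<open>
  Near each boundary point, in suitable orthonormal coordinates with last axis \<open>e\<close>, the set
  is the strict epigraph of a Lipschitz function of the remaining coordinates
  (the point \<open>z - (z \<bullet> e) e\<close> is the projection of \<open>z\<close> to the hyperplane orthogonal to \<open>e\<close>).
\<close>

definition lipschitz_boundary :: "(real^'n) set \<Rightarrow> bool" where
  "lipschitz_boundary \<Omega> \<longleftrightarrow>
     (\<forall>p\<in>frontier \<Omega>. \<exists>e r \<gamma> L. norm e = 1 \<and> r > 0 \<and> L-lipschitz_on {y. y \<bullet> e = 0} \<gamma> \<and>
        \<Omega> \<inter> ball p r = {z \<in> ball p r. \<gamma> (z - (z \<bullet> e) *\<^sub>R e) < z \<bullet> e})"

definition bounded_lipschitz_domain :: "(real^'n) set \<Rightarrow> bool" where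
  "bounded_lipschitz_domain \<Omega> \<longleftrightarrow>
     open \<Omega> \<and> connected \<Omega> \<and> \<Omega> \<noteq> {} \<and> bounded \<Omega> \<and> lipschitz_boundary \<Omega>"

text \<open>The value \<open>K 0\<close> is arbitrary; it does not influence any definition below.\<close>

definition admissible_kernel :: "(real^'n \<Rightarrow> real) \<Rightarrow> bool" where
  "admissible_kernel K \<longleftrightarrow>
     (\<forall>x. x \<noteq> 0 \<longrightarrow> K x > 0) \<and>
     integrable lebesgue (\<lambda>x. min ((norm x)\<^sup>2) 1 * K x) \<and>
     (\<exists>\<alpha> s. \<alpha> > 0 \<and> 0 < s \<and> s < 1 \<and> 2 * s < real CARD('n) \<and>
        (\<forall>x. x \<noteq> 0 \<longrightarrow> K x \<ge> \<alpha> * norm x powr (- (real CARD('n) + 2 * s)))) \<and>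
     (\<forall>x. x \<noteq> 0 \<longrightarrow> K (- x) = K x)"

definition inner_K :: "(real^'n \<Rightarrow> real) \<Rightarrow> (real^'n \<Rightarrow> real) \<Rightarrow> (real^'n \<Rightarrow> real) \<Rightarrow> real" where
  "inner_K K u v =
     (LINT z|lebesgue. (u (fst z) - u (snd z)) * (v (fst z) - v (snd z)) * K (fst z - snd z))"

definition norm_K :: "(real^'n \<Rightarrow> real) \<Rightarrow> (real^'n \<Rightarrow> real) \<Rightarrow> real" where
  "norm_K K u = sqrt (LINT z|lebesgue. (u (fst z) - u (snd z))\<^sup>2 * K (fst z - snd z))"

text \<open>The third conjunct expresses \<open>[u]\<^sub>K < \<infinity>\<close>, the integrand being nonnegative.\<close>

definition X_K :: "(real^'n \<Rightarrow> real) \<Rightarrow> (real^'n) set \<Rightarrow> (real^'n \<Rightarrow> real) set" where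
  "X_K K \<Omega> =
     {u. u \<in> borel_measurable lebesgue \<and>
         integrable lebesgue (\<lambda>x. (u x)\<^sup>2) \<and>
         integrable lebesgue (\<lambda>z. (u (fst z) - u (snd z))\<^sup>2 * K (fst z - snd z)) \<and>
         (AE x in lebesgue. x \<notin> \<Omega> \<longrightarrow> u x = 0)}"

definition L_infinity :: "(real^'n) set \<Rightarrow> (real^'n \<Rightarrow> real) set" where
  "L_infinity \<Omega> =
     {\<rho>. \<rho> \<in> borel_measurable (lebesgue_on \<Omega>) \<and> (\<exists>C. AE x in lebesgue_on \<Omega>. \<bar>\<rho> x\<bar> \<le> C)}"

text \<open>The set \<open>L\<^sup>\<infinity>(\<Omega>) \<setminus> {0}\<close>.\<close>

definition weights :: "(real^'n) set \<Rightarrow> (real^'n \<Rightarrow> real) set" where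
  "weights \<Omega> = {\<rho> \<in> L_infinity \<Omega>. \<not> (AE x in lebesgue_on \<Omega>. \<rho> x = 0)}"

definition eigenfunction ::
  "(real^'n \<Rightarrow> real) \<Rightarrow> (real^'n) set \<Rightarrow> (real^'n \<Rightarrow> real) \<Rightarrow> real \<Rightarrow> (real^'n \<Rightarrow> real) \<Rightarrow> bool" where
  "eigenfunction K \<Omega> \<rho> l u \<longleftrightarrow>
     u \<in> X_K K \<Omega> \<and> \<not> (AE x in lebesgue. u x = 0) \<and>
     (\<forall>v\<in>X_K K \<Omega>. inner_K K u v = l * (LINT x|lebesgue_on \<Omega>. \<rho> x * u x * v x))"

definition spectrum_K :: "(real^'n \<Rightarrow> real) \<Rightarrow> (real^'n) set \<Rightarrow> (real^'n \<Rightarrow> real) \<Rightarrow> real set" where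
  "spectrum_K K \<Omega> \<rho> = {l. \<exists>u. eigenfunction K \<Omega> \<rho> l u}"

definition ucp :: "(real^'n \<Rightarrow> real) \<Rightarrow> (real^'n) set \<Rightarrow> (real^'n \<Rightarrow> real) \<Rightarrow> bool" where
  "ucp K \<Omega> \<rho> \<longleftrightarrow>
     (\<forall>l\<in>spectrum_K K \<Omega> \<rho>. \<forall>u. eigenfunction K \<Omega> \<rho> l u \<longrightarrow>
        {x \<in> \<Omega>. u x = 0} \<in> null_sets lebesgue)"

text \<open>
  The family of \<open>k\<close>-dimensional linear subspaces of \<open>X\<^sub>K\<close>. A subspace is given as the set of
  all representatives of its elements, i.e. the span, up to equality almost everywhere, of
  \<open>k\<close> functions that are linearly independent modulo equality almost everywhere.
\<close>

definition subspaces_K ::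
  "(real^'n \<Rightarrow> real) \<Rightarrow> (real^'n) set \<Rightarrow> nat \<Rightarrow> (real^'n \<Rightarrow> real) set set" where
  "subspaces_K K \<Omega> k =
     {F. \<exists>b. (\<forall>i<k. b i \<in> X_K K \<Omega>) \<and>
        (\<forall>c::nat \<Rightarrow> real. (AE x in lebesgue. (\<Sum>i<k. c i * b i x) = 0) \<longrightarrow> (\<forall>i<k. c i = 0)) \<and>
        F = {v \<in> X_K K \<Omega>. \<exists>c::nat \<Rightarrow> real. AE x in lebesgue. v x = (\<Sum>i<k. c i * b i x)}}"

text \<open>
  The eigenvalue \<open>\<lambda>\<^sub>k(\<rho>)\<close> exists iff \<open>k > 0\<close> and \<open>\<rho>\<^sup>+ \<noteq> 0\<close>, or \<open>k < 0\<close> and \<open>\<rho>\<^sup>- \<noteq> 0\<close>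
  (not almost everywhere zero).
\<close>

definition eigval_exists :: "(real^'n) set \<Rightarrow> (real^'n \<Rightarrow> real) \<Rightarrow> int \<Rightarrow> bool" where
  "eigval_exists \<Omega> \<rho> k \<longleftrightarrow>
     (k > 0 \<and> \<not> (AE x in lebesgue_on \<Omega>. max (\<rho> x) 0 = 0)) \<or>
     (k < 0 \<and> \<not> (AE x in lebesgue_on \<Omega>. max (- \<rho> x) 0 = 0))"

text \<open>
  The eigenvalue \<open>\<lambda>\<^sub>k(\<rho>)\<close>, through its variational formula over \<open>\<bar>k\<bar>\<close>-dimensional subspaces:
  sup-inf for \<open>k > 0\<close>, inf-sup for \<open>k < 0\<close>. Only meaningful under \<^const>\<open>eigval_exists\<close>.
  For essentially bounded \<open>\<rho>\<close> all infima and suprema that occur are over nonempty bounded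
  sets of reals, by the Poincare inequality and since \<open>X\<^sub>K\<close> is infinite-dimensional.
\<close>

definition eigval ::
  "(real^'n \<Rightarrow> real) \<Rightarrow> (real^'n) set \<Rightarrow> (real^'n \<Rightarrow> real) \<Rightarrow> int \<Rightarrow> real" where
  "eigval K \<Omega> \<rho> k =
     (if k > 0
      then inverse (SUP F\<in>subspaces_K K \<Omega> (nat k).
             INF u\<in>{u \<in> F. norm_K K u = 1}. LINT x|lebesgue_on \<Omega>. \<rho> x * (u x)\<^sup>2)
      else inverse (INF F\<in>subspaces_K K \<Omega> (nat (- k)).
             SUP u\<in>{u \<in> F. norm_K K u = 1}. LINT x|lebesgue_on \<Omega>. \<rho> x * (u x)\<^sup>2))"

end

theory Submission
  imports Defs
begin

text \<open>
  Let \<open>u\<close> be an eigenfunction for \<open>\<lambda>\<close> that vanishes on a set \<open>Z \<subseteq> \<Omega>\<close> of positive measure; \<open>\<lambda> \<noteq> 0\<close>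
  because the energy \<open>\<langle>u, u\<rangle>\<close> is positive, and replacing \<open>\<rho>\<close> by \<open>-\<rho>\<close> (which turns the index \<open>k\<close>
  into \<open>-k\<close>) reduces the claim to \<open>\<lambda> > 0\<close>. The new weight is \<open>\<rho>' = \<rho> + \<epsilon> 1\<^sub>Z\<close>. Changing the weight
  on \<open>Z\<close> does not affect \<open>\<integral> \<rho> u v\<close>, so \<open>\<lambda>\<close> stays an eigenvalue; what has to be shown is that
  it keeps its index.

  Write \<open>\<mu> = 1 / \<lambda>\<close>, \<open>Q\<^sub>\<rho>(v) = \<integral> \<rho> v\<^sup>2\<close>, and \<open>\<mu>\<^sub>k(\<rho>)\<close> for the max-min value \<open>1 / \<lambda>\<^sub>k(\<rho>)\<close>. The
  eigenvalue equation says that \<open>u\<close> lies in the radical of the quadratic form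
  \<open>v \<mapsto> Q\<^sub>\<rho>(v) - \<mu> \<parallel>v\<parallel>\<^sup>2\<close>. Hence \<open>u\<close> can be adjoined to any subspace on which this form is nonnegative
  without destroying nonnegativity. The index \<open>k\<close> is the largest one with \<open>\<mu>\<^sub>k(\<rho>) \<ge> \<mu>\<close>; since
  \<open>\<rho>' \<ge> \<rho>\<close>, also \<open>\<mu>\<^sub>k(\<rho>') \<ge> \<mu>\<close>. If this were strict, there would be a \<open>k\<close>-dimensional subspace
  on which the form for \<open>\<rho>'\<close> is positive definite. It cannot contain \<open>u\<close>, and adjoining \<open>u\<close> gives
  \<open>k + 1\<close> dimensions with \<open>Q\<^sub>\<rho>' \<ge> \<mu> \<parallel>\<cdot>\<parallel>\<^sup>2\<close>, so that \<open>\<mu>\<^sub>k\<^sub>+\<^sub>1(\<rho>) \<ge> \<mu> - O(\<epsilon>)\<close>. For small \<open>\<epsilon>\<close> this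
  contradicts \<open>\<mu>\<^sub>k\<^sub>+\<^sub>1(\<rho>) < \<mu>\<close>. So \<open>\<mu>\<^sub>k(\<rho>') = \<mu>\<close>, and \<open>\<epsilon> = 0\<close> gives \<open>\<mu>\<^sub>k(\<rho>) = \<mu>\<close>
  (lemma \<open>maxmin_stable\<close>).

  A largest \<open>k\<close> exists because \<open>\<mu>\<^sub>k(\<rho>)\<close> falls below any positive bound. This is an elementary form of
  the compactness of \<open>X\<^sub>K \<subseteq> L\<^sup>2\<close>: on a cube \<open>C\<close> of side \<open>h\<close> the kernel is at least of order
  \<open>h\<^bsup>-(N+2s)\<^esup>\<close>, so a function with mean zero on \<open>C\<close> satisfies
  \<open>\<integral>\<^sub>C v\<^sup>2 \<le> const h\<^bsup>2s\<^esup> \<integral>\<^sub>C \<integral>\<^sub>C (v(x) - v(y))\<^sup>2 K(x - y)\<close>. Mean zero on each of the \<open>m\<close> disjoint cubes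
  that cover \<open>\<Omega>\<close> amounts to \<open>m\<close> linear conditions, and every subspace of dimension above \<open>m\<close> contains
  a nonzero function that satisfies them.
  The same estimate, with the second integral over a region outside \<open>\<Omega>\<close>, is the Poincare
  inequality.
\<close>

section \<open>Homogeneous linear systems\<close>

lemma homogeneous_system_nontrivial_solution:
  fixes a :: "'i \<Rightarrow> 'j \<Rightarrow> real"
  assumes "finite J" "finite I" "card J < card I"
  shows "\<exists>c. (\<exists>i\<in>I. c i \<noteq> 0) \<and> (\<forall>j\<in>J. (\<Sum>i\<in>I. c i * a i j) = 0)"
  using assms
proof (induction J arbitrary: I a rule: finite_induct)
  case empty
  then obtain i where "i \<in> I" by fastforce
  then show ?case by (intro exI[of _ "\<lambda>_. 1"]) auto
next
  case (insert j J)
  show ?case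
  proof (cases "\<forall>i\<in>I. a i j = 0")
    case True
    have "card J < card I" using insert by simp
    then obtain c where "\<exists>i\<in>I. c i \<noteq> 0" "\<forall>j\<in>J. (\<Sum>i\<in>I. c i * a i j) = 0"
      using insert.IH[OF insert.prems(1)] by blast
    then show ?thesis using True by (intro exI[of _ c]) auto
  next
    case False
    then obtain p where p: "p \<in> I" "a p j \<noteq> 0" by blast
    \<comment> \<open>Gaussian elimination: equation \<open>j\<close> is solved for the pivot unknown \<open>p\<close>.\<close>
    have "card J < card (I - {p})" using insert p by simp
    then obtain c where c: "\<exists>i\<in>I - {p}. c i \<noteq> 0"
        "\<forall>l\<in>J. (\<Sum>i\<in>I - {p}. c i * (a i l - a i j / a p j * a p l)) = 0"
      using insert.IH[of "I - {p}" "\<lambda>i l. a i l - a i j / a p j * a p l"] insert.prems(1) by blast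
    define d where "d i = (if i = p then - (\<Sum>i\<in>I - {p}. c i * a i j) / a p j else c i)" for i
    have split: "(\<Sum>i\<in>I. d i * a i l) = d p * a p l + (\<Sum>i\<in>I - {p}. c i * a i l)" for l
      using insert.prems(1) p by (subst sum.remove[of _ p]) (auto simp: d_def intro!: sum.cong)
    have "(\<Sum>i\<in>I. d i * a i l) = 0" if "l \<in> insert j J" for l
    proof (cases "l = j")
      case True
      then show ?thesis using p(2) by (simp only: split) (simp add: d_def)
    next
      case False
      then have "(\<Sum>i\<in>I - {p}. c i * (a i l - a i j / a p j * a p l)) = 0" using c(2) that by blast
      then have "(\<Sum>i\<in>I - {p}. c i * a i l) = (\<Sum>i\<in>I - {p}. c i * a i j) / a p j * a p l"
        by (simp add: right_diff_distrib sum_subtractf sum_distrib_right sum_divide_distrib mult.assoc)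
      then show ?thesis by (simp only: split) (simp add: d_def)
    qed
    moreover have "\<exists>i\<in>I. d i \<noteq> 0" using c(1) by (auto simp: d_def)
    ultimately show ?thesis by blast
  qed
qed

section \<open>Functions of one variable on the product space\<close>

lemma abs_mult_le_sum_squares: "\<bar>a * b\<bar> \<le> a\<^sup>2 + b\<^sup>2" for a b :: real
proof -
  have "2 * (\<bar>a\<bar> * \<bar>b\<bar>) \<le> a\<^sup>2 + b\<^sup>2"
    using zero_le_power2[of "\<bar>a\<bar> - \<bar>b\<bar>"] by (simp add: power2_diff mult.assoc)
  moreover have "0 \<le> \<bar>a\<bar> * \<bar>b\<bar>" by simp
  ultimately show ?thesis unfolding abs_mult by linarith
qed

lemma integrable_indicator_mult:
  fixes u :: "'a \<Rightarrow> real"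
  assumes [measurable]: "u \<in> borel_measurable M" "A \<in> sets M"
    and fin: "emeasure M A < \<infinity>" and int: "integrable M (\<lambda>x. (u x)\<^sup>2)"
  shows "integrable M (\<lambda>x. indicator A x * u x)"
proof (rule Bochner_Integration.integrable_bound)
  show "integrable M (\<lambda>x. indicator A x + (u x)\<^sup>2)"
    using fin int by (intro Bochner_Integration.integrable_add) (auto simp: integrable_indicator_iff)
  show "AE x in M. norm (indicator A x * u x) \<le> norm (indicator A x + (u x)\<^sup>2)"
    using abs_mult_le_sum_squares[of 1] by (intro AE_I2) (auto simp: indicator_def)
qed measurable

text \<open>
  The energies are integrals over the completed product measure, whereas Tonelli's theorem concerns
  the product of the measures. Passing to Borel representatives bridges the gap, because null
  sets of one factor induce null cylinders in the product.
\<close>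
lemma AE_lebesgue_fst:
  fixes P :: "'a::euclidean_space \<Rightarrow> bool"
  assumes "AE x in lebesgue. P x"
  shows "AE z in (lebesgue :: ('a \<times> 'b::euclidean_space) measure). P (fst z)"
proof -
  have "AE x in lborel. P x"
    using assms by (simp add: AE_completion_iff)
  then obtain N where N: "{x. \<not> P x} \<subseteq> N" "N \<in> null_sets lborel"
    by (auto simp: eventually_ae_filter)
  have "N \<times> (UNIV :: 'b set) \<in> null_sets (lborel \<Otimes>\<^sub>M lborel)"
    using N(2) by (intro lborel.times_in_null_sets1) auto
  then have "N \<times> (UNIV :: 'b set) \<in> null_sets lborel"
    by (simp add: lborel_prod)
  then have "AE z in (lborel :: ('a \<times> 'b) measure). P (fst z)"
    by (rule AE_I') (use N(1) in auto)
  then show ?thesis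
    by (rule AE_completion)
qed

lemma AE_lebesgue_snd:
  fixes P :: "'b::euclidean_space \<Rightarrow> bool"
  assumes "AE x in lebesgue. P x"
  shows "AE z in (lebesgue :: ('a::euclidean_space \<times> 'b) measure). P (snd z)"
proof -
  have "AE x in lborel. P x"
    using assms by (simp add: AE_completion_iff)
  then obtain N where N: "{x. \<not> P x} \<subseteq> N" "N \<in> null_sets lborel"
    by (auto simp: eventually_ae_filter)
  have "(UNIV :: 'a set) \<times> N \<in> null_sets (lborel \<Otimes>\<^sub>M lborel)"
    using N(2) by (intro lborel.times_in_null_sets2) auto
  then have "(UNIV :: 'a set) \<times> N \<in> null_sets lborel"
    by (simp add: lborel_prod)
  then have "AE z in (lborel :: ('a \<times> 'b) measure). P (snd z)"
    by (rule AE_I') (use N(1) in auto)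
  then show ?thesis
    by (rule AE_completion)
qed

lemma lebesgue_borel_representative:
  fixes u :: "'a::euclidean_space \<Rightarrow> real"
  assumes "u \<in> borel_measurable lebesgue"
  obtains u' where "u' \<in> borel_measurable borel" "AE x in lebesgue. u' x = u x"
proof -
  obtain u' where u': "u' \<in> borel_measurable lborel" "AE x in lborel. u x = u' x"
    using completion_ex_borel_measurable_real[OF assms] by blast
  have "AE x in lebesgue. u x = u' x"
    by (rule AE_completion[OF u'(2)])
  then have "AE x in lebesgue. u' x = u x"
    by eventually_elim simp
  with u'(1) that show ?thesis by simp
qed

lemma borel_measurable_lebesgue_fst:
  fixes u :: "'a::euclidean_space \<Rightarrow> real"
  assumes "u \<in> borel_measurable lebesgue"
  shows "(\<lambda>z. u (fst z)) \<in> borel_measurable (lebesgue :: ('a \<times> 'b::euclidean_space) measure)"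
proof -
  obtain u' where [measurable]: "u' \<in> borel_measurable borel" and ae: "AE x in lebesgue. u' x = u x"
    using lebesgue_borel_representative[OF assms] .
  have "(\<lambda>z. u' (fst z)) \<in> borel_measurable (lebesgue :: ('a \<times> 'b::euclidean_space) measure)"
    by (intro measurable_completion) (simp add: borel_prod[symmetric])
  then show ?thesis
    by (rule borel_measurable_AE) (use AE_lebesgue_fst[OF ae] in simp)
qed

lemma borel_measurable_lebesgue_snd:
  fixes u :: "'b::euclidean_space \<Rightarrow> real"
  assumes "u \<in> borel_measurable lebesgue"
  shows "(\<lambda>z. u (snd z)) \<in> borel_measurable (lebesgue :: ('a::euclidean_space \<times> 'b) measure)"
proof -
  obtain u' where [measurable]: "u' \<in> borel_measurable borel" and ae: "AE x in lebesgue. u' x = u x"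
    using lebesgue_borel_representative[OF assms] .
  have "(\<lambda>z. u' (snd z)) \<in> borel_measurable (lebesgue :: ('a::euclidean_space \<times> 'b) measure)"
    by (intro measurable_completion) (simp add: borel_prod[symmetric])
  then show ?thesis
    by (rule borel_measurable_AE) (use AE_lebesgue_snd[OF ae] in simp)
qed

text \<open>
  For fixed \<open>x\<close>, expanding the square gives
  \<open>\<integral>\<^sub>B (u(x) - u(y))\<^sup>2 dy = |B| u(x)\<^sup>2 - 2 u(x) \<integral>\<^sub>B u + \<integral>\<^sub>B u\<^sup>2\<close>. The middle term vanishes, the last one is
  nonnegative, and integration over \<open>x \<in> A\<close> gives the bound. This single inequality
  yields both the Poincare inequality and compactness.
\<close>
lemma mean_zero_energy_borel:
  fixes u :: "'a::euclidean_space \<Rightarrow> real"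
  assumes [measurable]: "u \<in> borel_measurable borel" "A \<in> sets borel" "B \<in> sets borel"
    and fin: "emeasure lborel B < \<infinity>"
    and int: "integrable lborel (\<lambda>x. (u x)\<^sup>2)"
    and mean: "(LINT x|lborel. indicator B x * u x) = 0"
  shows "ennreal (measure lborel B) * (\<integral>\<^sup>+x. indicator A x * ennreal ((u x)\<^sup>2) \<partial>lborel)
         \<le> (\<integral>\<^sup>+z. indicator (A \<times> B) z * ennreal ((u (fst z) - u (snd z))\<^sup>2) \<partial>lborel)"
proof -
  have intB: "integrable lborel (indicator B :: 'a \<Rightarrow> real)"
    using fin by (simp add: integrable_indicator_iff)
  have intBu2: "integrable lborel (\<lambda>x. indicator B x * (u x)\<^sup>2)"
    by (rule Bochner_Integration.integrable_bound[OF int]) (auto simp: indicator_def)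
  have intBu: "integrable lborel (\<lambda>x. indicator B x * u x)"
    using fin int by (intro integrable_indicator_mult) auto
  have inner: "ennreal (measure lborel B) * ennreal ((u x)\<^sup>2)
      \<le> (\<integral>\<^sup>+y. indicator B y * ennreal ((u x - u y)\<^sup>2) \<partial>lborel)" for x
  proof -
    have eq: "(\<lambda>y. indicator B y * (u x - u y)\<^sup>2)
       = (\<lambda>y. (u x)\<^sup>2 * indicator B y - 2 * u x * (indicator B y * u y) + indicator B y * (u y)\<^sup>2)"
      by (auto simp: fun_eq_iff power2_diff algebra_simps)
    have i: "integrable lborel (\<lambda>y. indicator B y * (u x - u y)\<^sup>2)"
      unfolding eq using intB intBu intBu2 by (intro Bochner_Integration.integrable_add Bochner_Integration.integrable_diff integrable_mult_right)
    have "(LINT y|lborel. indicator B y * (u x - u y)\<^sup>2)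
        = (u x)\<^sup>2 * measure lborel B + (LINT y|lborel. indicator B y * (u y)\<^sup>2)"
      unfolding eq using intB intBu intBu2 mean by simp
    then have "measure lborel B * (u x)\<^sup>2 \<le> (LINT y|lborel. indicator B y * (u x - u y)\<^sup>2)"
      by (simp add: mult.commute integral_nonneg_AE)
    then have "ennreal (measure lborel B * (u x)\<^sup>2) \<le> ennreal (LINT y|lborel. indicator B y * (u x - u y)\<^sup>2)"
      by (rule ennreal_leI)
    also have "\<dots> = (\<integral>\<^sup>+y. ennreal (indicator B y * (u x - u y)\<^sup>2) \<partial>lborel)"
      by (rule nn_integral_eq_integral[symmetric, OF i]) auto
    finally show ?thesis
      by (simp add: ennreal_mult' ennreal_indicator)
  qed
  have "ennreal (measure lborel B) * (\<integral>\<^sup>+x. indicator A x * ennreal ((u x)\<^sup>2) \<partial>lborel)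
      = (\<integral>\<^sup>+x. indicator A x * (ennreal (measure lborel B) * ennreal ((u x)\<^sup>2)) \<partial>lborel)"
    by (subst nn_integral_cmult[symmetric]) (auto simp: mult.left_commute)
  also have "\<dots> \<le> (\<integral>\<^sup>+x. indicator A x * (\<integral>\<^sup>+y. indicator B y * ennreal ((u x - u y)\<^sup>2) \<partial>lborel) \<partial>lborel)"
    by (intro nn_integral_mono mult_left_mono inner) simp
  also have "\<dots> = (\<integral>\<^sup>+x. \<integral>\<^sup>+y. indicator (A \<times> B) (x, y) * ennreal ((u (fst (x, y)) - u (snd (x, y)))\<^sup>2) \<partial>lborel \<partial>lborel)"
    by (subst nn_integral_cmult[symmetric]) (auto simp: indicator_times mult.assoc)
  also have "\<dots> = (\<integral>\<^sup>+z. indicator (A \<times> B) z * ennreal ((u (fst z) - u (snd z))\<^sup>2) \<partial>(lborel \<Otimes>\<^sub>M lborel))"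
    by (rule lborel.nn_integral_fst) measurable
  finally show ?thesis
    by (simp add: lborel_prod)
qed

lemma mean_zero_energy:
  fixes u :: "'a::euclidean_space \<Rightarrow> real"
  assumes u: "u \<in> borel_measurable lebesgue" "integrable lebesgue (\<lambda>x. (u x)\<^sup>2)"
    and AB: "A \<in> sets borel" "B \<in> sets borel"
    and fin: "emeasure lborel B < \<infinity>"
    and mean: "(LINT x|lebesgue. indicator B x * u x) = 0"
  shows "ennreal (measure lborel B) * (\<integral>\<^sup>+x. indicator A x * ennreal ((u x)\<^sup>2) \<partial>lebesgue)
         \<le> (\<integral>\<^sup>+z. indicator (A \<times> B) z * ennreal ((u (fst z) - u (snd z))\<^sup>2) \<partial>lebesgue)"
proof -
  obtain u' where u': "u' \<in> borel_measurable borel" and ae: "AE x in lebesgue. u' x = u x"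
    using lebesgue_borel_representative[OF u(1)] .
  have m1: "u' \<in> borel_measurable lebesgue" "(indicator B :: 'a \<Rightarrow> real) \<in> borel_measurable lebesgue"
    using u' AB by (auto intro!: measurable_completion)
  have "integrable lebesgue (\<lambda>x. (u' x)\<^sup>2)"
    using u(2) by (rule Bochner_Integration.integrable_cong_AE_imp) (use m1 ae in auto)
  then have i: "integrable lborel (\<lambda>x. (u' x)\<^sup>2)"
    using u' by (subst (asm) integrable_completion) auto
  have "(LINT x|lebesgue. indicator B x * u' x) = (LINT x|lebesgue. indicator B x * u x)"
    by (rule integral_cong_AE) (use u m1 ae AB in auto)
  then have "(LINT x|lborel. indicator B x * u' x) = 0"
    using mean u' AB by (subst (asm) integral_completion) auto
  note * = mean_zero_energy_borel[OF u' AB fin i this]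
  have "(\<integral>\<^sup>+x. indicator A x * ennreal ((u x)\<^sup>2) \<partial>lebesgue) = (\<integral>\<^sup>+x. indicator A x * ennreal ((u' x)\<^sup>2) \<partial>lebesgue)"
    by (rule nn_integral_cong_AE) (use ae in auto)
  moreover have aez: "AE z in (lebesgue :: ('a \<times> 'a) measure). u' (fst z) = u (fst z) \<and> u' (snd z) = u (snd z)"
    using AE_lebesgue_fst[OF ae] AE_lebesgue_snd[OF ae] by eventually_elim auto
  have "(\<integral>\<^sup>+z. indicator (A \<times> B) z * ennreal ((u (fst z) - u (snd z))\<^sup>2) \<partial>lebesgue)
     = (\<integral>\<^sup>+z. indicator (A \<times> B) z * ennreal ((u' (fst z) - u' (snd z))\<^sup>2) \<partial>lebesgue)"
    by (rule nn_integral_cong_AE, use aez in eventually_elim, simp)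
  ultimately show ?thesis
    using * by (simp add: nn_integral_completion)
qed

section \<open>The energy space\<close>

locale singular_kernel =
  fixes K :: "real^'n \<Rightarrow> real" and \<Omega> :: "(real^'n) set" and \<alpha> s :: real
  assumes open_domain: "open \<Omega>" and bounded_domain: "bounded \<Omega>"
    and alpha_pos: "\<alpha> > 0" and s_pos: "s > 0"
    and kernel_lower: "\<And>x. x \<noteq> 0 \<Longrightarrow> \<alpha> * norm x powr (- (real CARD('n) + 2 * s)) \<le> K x"
begin

abbreviation X :: "(real^'n \<Rightarrow> real) set" where "X \<equiv> X_K K \<Omega>"
abbreviation E :: "(real^'n \<Rightarrow> real) \<Rightarrow> (real^'n \<Rightarrow> real) \<Rightarrow> real" where "E \<equiv> inner_K K"

lemma kernel_nonneg: "x \<noteq> 0 \<Longrightarrow> 0 \<le> K x"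
  using kernel_lower[of x] alpha_pos by (meson mult_nonneg_nonneg order_trans powr_ge_zero less_imp_le)

lemma kernel_ge_on_bounded:
  assumes "x \<noteq> 0" "norm x \<le> d"
  shows "\<alpha> * d powr (- (real CARD('n) + 2 * s)) \<le> K x"
proof -
  have "d powr (- (real CARD('n) + 2 * s)) \<le> norm x powr (- (real CARD('n) + 2 * s))"
    using assms s_pos by (intro powr_mono2') auto
  then show ?thesis
    using kernel_lower[OF assms(1)] alpha_pos by (meson mult_left_mono order_trans less_imp_le)
qed

lemma X_measurable: "u \<in> X \<Longrightarrow> u \<in> borel_measurable lebesgue"
  and X_square_integrable: "u \<in> X \<Longrightarrow> integrable lebesgue (\<lambda>x. (u x)\<^sup>2)"
  and X_energy_integrable: "u \<in> X \<Longrightarrow> integrable lebesgue (\<lambda>z. (u (fst z) - u (snd z))\<^sup>2 * K (fst z - snd z))"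
  and X_zero_outside: "u \<in> X \<Longrightarrow> AE x in lebesgue. x \<notin> \<Omega> \<longrightarrow> u x = 0"
  by (auto simp: X_K_def)

lemma energy_density_nonneg: "0 \<le> (u (fst z) - u (snd z))\<^sup>2 * K (fst z - snd z)"
  using kernel_nonneg[of "fst z - snd z"] by (cases "fst z = snd z") auto

lemma E_self: "E u u = (LINT z|lebesgue. (u (fst z) - u (snd z))\<^sup>2 * K (fst z - snd z))"
  by (simp add: inner_K_def power2_eq_square)

lemma E_nonneg: "0 \<le> E u u"
  unfolding E_self by (intro integral_nonneg_AE AE_I2 energy_density_nonneg)

lemma norm_K_eq: "norm_K K u = sqrt (E u u)"
  by (simp add: norm_K_def E_self)

lemma E_commute: "E u v = E v u"
  by (simp add: inner_K_def mult.commute)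

text \<open>
  The product is dominated by the sum of the two energy densities. It is measurable because it is the
  energy density of \<open>u\<close> times \<open>(v(x) - v(y)) / (u(x) - u(y))\<close>, the convention \<open>a / 0 = 0\<close>
  giving the right value where \<open>u(x) = u(y)\<close>.
\<close>
lemma E_integrable:
  assumes u: "u \<in> X" and v: "v \<in> X"
  shows "integrable lebesgue (\<lambda>z. (u (fst z) - u (snd z)) * (v (fst z) - v (snd z)) * K (fst z - snd z))"
proof (rule Bochner_Integration.integrable_bound)
  show "integrable lebesgue (\<lambda>z. (u (fst z) - u (snd z))\<^sup>2 * K (fst z - snd z) + (v (fst z) - v (snd z))\<^sup>2 * K (fst z - snd z))"
    using u v by (intro Bochner_Integration.integrable_add X_energy_integrable)
  have [measurable]: "(\<lambda>z. u (fst z)) \<in> borel_measurable (lebesgue :: ((real^'n) \<times> (real^'n)) measure)"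
    "(\<lambda>z. u (snd z)) \<in> borel_measurable (lebesgue :: ((real^'n) \<times> (real^'n)) measure)"
    "(\<lambda>z. v (fst z)) \<in> borel_measurable (lebesgue :: ((real^'n) \<times> (real^'n)) measure)"
    "(\<lambda>z. v (snd z)) \<in> borel_measurable (lebesgue :: ((real^'n) \<times> (real^'n)) measure)"
    using u v by (auto intro!: borel_measurable_lebesgue_fst borel_measurable_lebesgue_snd X_measurable)
  have [measurable]: "(\<lambda>z. (u (fst z) - u (snd z))\<^sup>2 * K (fst z - snd z)) \<in> borel_measurable lebesgue"
    using X_energy_integrable[OF u] by (rule borel_measurable_integrable)
  have "(\<lambda>z. ((v (fst z) - v (snd z)) / (u (fst z) - u (snd z))) * ((u (fst z) - u (snd z))\<^sup>2 * K (fst z - snd z))) \<in> borel_measurable lebesgue"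
    by measurable
  also have "(\<lambda>z. ((v (fst z) - v (snd z)) / (u (fst z) - u (snd z))) * ((u (fst z) - u (snd z))\<^sup>2 * K (fst z - snd z)))
     = (\<lambda>z. (u (fst z) - u (snd z)) * (v (fst z) - v (snd z)) * K (fst z - snd z))"
    by (auto simp: fun_eq_iff power2_eq_square)
  finally show "(\<lambda>z. (u (fst z) - u (snd z)) * (v (fst z) - v (snd z)) * K (fst z - snd z)) \<in> borel_measurable lebesgue" .
  show "AE z in lebesgue. norm ((u (fst z) - u (snd z)) * (v (fst z) - v (snd z)) * K (fst z - snd z))
     \<le> norm ((u (fst z) - u (snd z))\<^sup>2 * K (fst z - snd z) + (v (fst z) - v (snd z))\<^sup>2 * K (fst z - snd z))"
  proof (intro AE_I2)
    fix z :: "(real^'n) \<times> (real^'n)"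
    show "norm ((u (fst z) - u (snd z)) * (v (fst z) - v (snd z)) * K (fst z - snd z))
     \<le> norm ((u (fst z) - u (snd z))\<^sup>2 * K (fst z - snd z) + (v (fst z) - v (snd z))\<^sup>2 * K (fst z - snd z))"
    proof (cases "fst z = snd z")
      case False
      then have k: "0 \<le> K (fst z - snd z)" using kernel_nonneg by simp
      then show ?thesis
        using mult_right_mono[OF abs_mult_le_sum_squares[of "u (fst z) - u (snd z)" "v (fst z) - v (snd z)"] k]
        by (simp add: abs_mult distrib_right)
    qed simp
  qed
qed

lemma E_expand:
  assumes u: "u \<in> X" and v: "v \<in> X"
  shows "integrable lebesgue (\<lambda>z. ((u (fst z) + c * v (fst z)) - (u (snd z) + c * v (snd z)))\<^sup>2 * K (fst z - snd z))"
    and "E (\<lambda>x. u x + c * v x) (\<lambda>x. u x + c * v x) = E u u + 2 * c * E u v + c\<^sup>2 * E v v"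
proof -
  have eq: "((u (fst z) + c * v (fst z)) - (u (snd z) + c * v (snd z)))\<^sup>2 * K (fst z - snd z)
      = (u (fst z) - u (snd z)) * (u (fst z) - u (snd z)) * K (fst z - snd z)
       + 2 * c * ((u (fst z) - u (snd z)) * (v (fst z) - v (snd z)) * K (fst z - snd z))
       + c\<^sup>2 * ((v (fst z) - v (snd z)) * (v (fst z) - v (snd z)) * K (fst z - snd z))" for z
    by (simp add: power2_eq_square algebra_simps)
  note i = E_integrable[OF u u] E_integrable[OF u v] E_integrable[OF v v]
  show "integrable lebesgue (\<lambda>z. ((u (fst z) + c * v (fst z)) - (u (snd z) + c * v (snd z)))\<^sup>2 * K (fst z - snd z))"
    unfolding eq using i by (intro Bochner_Integration.integrable_add integrable_mult_right)
  show "E (\<lambda>x. u x + c * v x) (\<lambda>x. u x + c * v x) = E u u + 2 * c * E u v + c\<^sup>2 * E v v"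
    unfolding E_self eq unfolding inner_K_def using i
    by (simp add: power2_eq_square)
qed

lemma X_add_scaled:
  assumes u: "u \<in> X" and v: "v \<in> X"
  shows "(\<lambda>x. u x + c * v x) \<in> X"
proof -
  have [measurable]: "u \<in> borel_measurable lebesgue" "v \<in> borel_measurable lebesgue"
    using u v X_measurable by auto
  have "integrable lebesgue (\<lambda>x. (u x + c * v x)\<^sup>2)"
  proof (rule Bochner_Integration.integrable_bound)
    show "integrable lebesgue (\<lambda>x. 2 * (u x)\<^sup>2 + 2 * c\<^sup>2 * (v x)\<^sup>2)"
      using u v by (intro Bochner_Integration.integrable_add integrable_mult_right X_square_integrable)
    have "(a + b)\<^sup>2 \<le> 2 * a\<^sup>2 + 2 * b\<^sup>2" for a b :: real
      using zero_le_power2[of "a - b"] by (simp add: power2_diff power2_sum)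
    from this[of "u x" "c * v x" for x]
    show "AE x in lebesgue. norm ((u x + c * v x)\<^sup>2) \<le> norm (2 * (u x)\<^sup>2 + 2 * c\<^sup>2 * (v x)\<^sup>2)"
      by (intro AE_I2) (simp add: power_mult_distrib mult.assoc)
  qed measurable
  moreover have "AE x in lebesgue. x \<notin> \<Omega> \<longrightarrow> u x + c * v x = 0"
    using X_zero_outside[OF u] X_zero_outside[OF v] by eventually_elim auto
  ultimately show ?thesis
    using E_expand(1)[OF u v, of c] by (auto simp: X_K_def)
qed

lemma X_zero: "(\<lambda>x. 0) \<in> X"
  by (simp add: X_K_def)

lemma X_scaled: "u \<in> X \<Longrightarrow> (\<lambda>x. c * u x) \<in> X"
  using X_add_scaled[OF X_zero, of u c] by simp

lemma X_sum:
  assumes "\<And>i. i < k \<Longrightarrow> b i \<in> X"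
  shows "(\<lambda>x. \<Sum>i<(k::nat). c i * b i x) \<in> X"
  using assms
proof (induction k)
  case 0
  then show ?case by (simp add: X_zero)
next
  case (Suc k)
  then have "(\<lambda>x. (\<Sum>i<k. c i * b i x) + c k * b k x) \<in> X"
    by (intro X_add_scaled) auto
  then show ?case by simp
qed

lemma E_scaled: "u \<in> X \<Longrightarrow> E (\<lambda>x. c * u x) (\<lambda>x. c * u x) = c\<^sup>2 * E u u"
  using E_expand(2)[OF X_zero, of u c] by (simp add: inner_K_def)

lemma E_cong_AE:
  assumes X: "u \<in> X" "v \<in> X" "u' \<in> X" "v' \<in> X"
    and u: "AE x in lebesgue. u x = u' x" and v: "AE x in lebesgue. v x = v' x"
  shows "E u v = E u' v'"
  unfolding inner_K_def
proof (rule integral_cong_AE)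
  show "(\<lambda>z. (u (fst z) - u (snd z)) * (v (fst z) - v (snd z)) * K (fst z - snd z)) \<in> borel_measurable lebesgue"
       "(\<lambda>z. (u' (fst z) - u' (snd z)) * (v' (fst z) - v' (snd z)) * K (fst z - snd z)) \<in> borel_measurable lebesgue"
    using X by (auto intro!: borel_measurable_integrable E_integrable)
  show "AE z in lebesgue. (u (fst z) - u (snd z)) * (v (fst z) - v (snd z)) * K (fst z - snd z)
     = (u' (fst z) - u' (snd z)) * (v' (fst z) - v' (snd z)) * K (fst z - snd z)"
    using AE_lebesgue_fst[OF u] AE_lebesgue_snd[OF u] AE_lebesgue_fst[OF v] AE_lebesgue_snd[OF v]
    by eventually_elim simp
qed

text \<open>
  The sets \<open>A i \<times> B i\<close> are disjoint, so the energies collected on them add up to at most the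
  full energy. Two choices matter: \<open>B i = A i\<close> a cube of a fine grid, and a single
  \<open>A i \<supseteq> \<Omega>\<close> with \<open>B i\<close> a ball far from \<open>\<Omega>\<close>, where \<open>u\<close> vanishes.
\<close>
lemma energy_controls_L2:
  assumes u: "u \<in> X" and I: "finite I" and disj: "disjoint_family_on A I"
    and A: "\<And>i. i \<in> I \<Longrightarrow> A i \<in> sets borel" and B: "\<And>i. i \<in> I \<Longrightarrow> B i \<in> sets borel"
    and fin: "\<And>i. i \<in> I \<Longrightarrow> emeasure lborel (B i) < \<infinity>"
    and vol: "\<And>i. i \<in> I \<Longrightarrow> b \<le> measure lborel (B i)"
    and mean: "\<And>i. i \<in> I \<Longrightarrow> (LINT x|lebesgue. indicator (B i) x * u x) = 0"
    and lower: "\<And>i x y. i \<in> I \<Longrightarrow> x \<in> A i \<Longrightarrow> y \<in> B i \<Longrightarrow> x \<noteq> y \<Longrightarrow> c \<le> K (x - y)"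
    and c: "c \<ge> 0" and b: "b \<ge> 0" and cover: "\<Omega> \<subseteq> (\<Union>i\<in>I. A i)"
  shows "c * b * (LINT x|lebesgue. (u x)\<^sup>2) \<le> E u u"
proof -
  have [measurable]: "u \<in> borel_measurable lebesgue" using u X_measurable by auto
  have [measurable]: "(\<lambda>z. u (fst z)) \<in> borel_measurable (lebesgue :: ((real^'n) \<times> (real^'n)) measure)"
    "(\<lambda>z. u (snd z)) \<in> borel_measurable (lebesgue :: ((real^'n) \<times> (real^'n)) measure)"
    using u by (auto intro!: borel_measurable_lebesgue_fst borel_measurable_lebesgue_snd X_measurable)
  have Am: "i \<in> I \<Longrightarrow> A i \<in> sets lebesgue" for i using A by auto
  have ABm: "i \<in> I \<Longrightarrow> A i \<times> B i \<in> sets lebesgue" for i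
    using A[of i] B[of i] by (auto intro!: borel_Times)
  let ?e = "\<lambda>z. (u (fst z) - u (snd z))\<^sup>2"
  have "ennreal (c * b * (LINT x|lebesgue. (u x)\<^sup>2)) = ennreal (c * b) * (\<integral>\<^sup>+x. ennreal ((u x)\<^sup>2) \<partial>lebesgue)"
    using nn_integral_eq_integral[OF X_square_integrable[OF u]] b c by (simp add: ennreal_mult integral_nonneg_AE)
  also have "(\<integral>\<^sup>+x. ennreal ((u x)\<^sup>2) \<partial>lebesgue) \<le> (\<integral>\<^sup>+x. (\<Sum>i\<in>I. indicator (A i) x * ennreal ((u x)\<^sup>2)) \<partial>lebesgue)"
  proof (rule nn_integral_mono_AE, use X_zero_outside[OF u] in eventually_elim)
    fix x assume x: "x \<notin> \<Omega> \<longrightarrow> u x = 0"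
    show "ennreal ((u x)\<^sup>2) \<le> (\<Sum>i\<in>I. indicator (A i) x * ennreal ((u x)\<^sup>2))"
    proof (cases "u x = 0")
      case False
      then obtain i where i: "i \<in> I" "x \<in> A i" using x cover by auto
      then have "ennreal ((u x)\<^sup>2) = indicator (A i) x * ennreal ((u x)\<^sup>2)" by simp
      also have "\<dots> \<le> (\<Sum>i\<in>I. indicator (A i) x * ennreal ((u x)\<^sup>2))"
        by (rule member_le_sum) (use i I in auto)
      finally show ?thesis .
    qed simp
  qed
  also have "\<dots> = (\<Sum>i\<in>I. \<integral>\<^sup>+x. indicator (A i) x * ennreal ((u x)\<^sup>2) \<partial>lebesgue)"
    by (rule nn_integral_sum) (use Am in measurable)
  also have "ennreal (c * b) * (\<Sum>i\<in>I. \<integral>\<^sup>+x. indicator (A i) x * ennreal ((u x)\<^sup>2) \<partial>lebesgue)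
     = (\<Sum>i\<in>I. ennreal c * (ennreal b * (\<integral>\<^sup>+x. indicator (A i) x * ennreal ((u x)\<^sup>2) \<partial>lebesgue)))"
    using b c by (simp add: sum_distrib_left ennreal_mult mult.assoc)
  also have "\<dots> \<le> (\<Sum>i\<in>I. ennreal c * (\<integral>\<^sup>+z. indicator (A i \<times> B i) z * ennreal (?e z) \<partial>lebesgue))"
  proof (intro sum_mono mult_left_mono)
    fix i assume i: "i \<in> I"
    have "ennreal b * (\<integral>\<^sup>+x. indicator (A i) x * ennreal ((u x)\<^sup>2) \<partial>lebesgue)
      \<le> ennreal (measure lborel (B i)) * (\<integral>\<^sup>+x. indicator (A i) x * ennreal ((u x)\<^sup>2) \<partial>lebesgue)"
      by (intro mult_right_mono ennreal_leI vol i) simp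
    also have "\<dots> \<le> (\<integral>\<^sup>+z. indicator (A i \<times> B i) z * ennreal (?e z) \<partial>lebesgue)"
      by (rule mean_zero_energy[OF X_measurable[OF u] X_square_integrable[OF u] A[OF i] B[OF i] fin[OF i] mean[OF i]])
    finally show "ennreal b * (\<integral>\<^sup>+x. indicator (A i) x * ennreal ((u x)\<^sup>2) \<partial>lebesgue)
       \<le> (\<integral>\<^sup>+z. indicator (A i \<times> B i) z * ennreal (?e z) \<partial>lebesgue)" .
  qed simp
  also have "\<dots> = (\<Sum>i\<in>I. (\<integral>\<^sup>+z. ennreal c * (indicator (A i \<times> B i) z * ennreal (?e z)) \<partial>lebesgue))"
    by (intro sum.cong refl nn_integral_cmult[symmetric]) (use ABm in measurable)
  also have "\<dots> = (\<integral>\<^sup>+z. (\<Sum>i\<in>I. ennreal c * (indicator (A i \<times> B i) z * ennreal (?e z))) \<partial>lebesgue)"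
    by (rule nn_integral_sum[symmetric]) (use ABm in measurable)
  also have "\<dots> \<le> (\<integral>\<^sup>+z. ennreal (?e z * K (fst z - snd z)) \<partial>lebesgue)"
  proof (rule nn_integral_mono)
    fix z :: "(real^'n) \<times> (real^'n)"
    show "(\<Sum>i\<in>I. ennreal c * (indicator (A i \<times> B i) z * ennreal (?e z))) \<le> ennreal (?e z * K (fst z - snd z))"
    proof (cases "\<exists>i\<in>I. z \<in> A i \<times> B i")
      case True
      then obtain i where i: "i \<in> I" "z \<in> A i \<times> B i" by auto
      have "j \<in> I \<Longrightarrow> j \<noteq> i \<Longrightarrow> z \<notin> A j \<times> B j" for j
        using i disj by (auto simp: disjoint_family_on_def)
      then have "(\<Sum>j\<in>I. ennreal c * (indicator (A j \<times> B j) z * ennreal (?e z)))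
        = (\<Sum>j\<in>I. if j = i then ennreal c * ennreal (?e z) else 0)"
        using i by (intro sum.cong) auto
      also have "\<dots> = ennreal (?e z * c)"
        using i I c by (simp add: ennreal_mult' mult.commute)
      also have "\<dots> \<le> ennreal (?e z * K (fst z - snd z))"
      proof (cases "fst z = snd z")
        case False
        then show ?thesis
          using lower[OF i(1), of "fst z" "snd z"] i(2) by (intro ennreal_leI mult_left_mono) auto
      qed simp
      finally show ?thesis .
    next
      case False
      then show ?thesis by (auto simp: indicator_def)
    qed
  qed
  also have "\<dots> = ennreal (E u u)"
    unfolding E_self by (intro nn_integral_eq_integral X_energy_integrable u AE_I2 energy_density_nonneg)
  finally show ?thesis
    using E_nonneg by (simp add: mult_left_mono)
qed

section \<open>Poincare inequality and compactness\<close>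

lemma poincare:
  obtains c where "c > 0" "\<And>u. u \<in> X \<Longrightarrow> c * (LINT x|lebesgue. (u x)\<^sup>2) \<le> E u u"
proof -
  obtain R where R: "R > 0" "\<Omega> \<subseteq> ball 0 R"
    using bounded_domain bounded_subset_ballD by blast
  obtain p :: "real^'n" where p: "norm p = R + 2"
    using vector_choose_size[of "R + 2"] R by auto
  define c where "c = \<alpha> * (2 * R + 3) powr (- (real CARD('n) + 2 * s))"
  define b where "b = measure lborel (ball p 1)"
  have c: "c > 0" unfolding c_def using alpha_pos R by simp
  have b: "b > 0" unfolding b_def by (simp add: content_ball_pos)
  have far: "x \<notin> ball p 1" if "x \<in> ball 0 R" for x
    using that p norm_triangle_ineq[of "p - x" x] by (auto simp: dist_norm)
  have "c * b * (LINT x|lebesgue. (u x)\<^sup>2) \<le> E u u" if u: "u \<in> X" for u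
  proof (rule energy_controls_L2[where I = "{()}" and A = "\<lambda>_. ball 0 R" and B = "\<lambda>_. ball p 1"])
    show "(LINT x|lebesgue. indicator (ball p 1) x * u x) = 0"
    proof (rule integral_eq_zero_AE, use X_zero_outside[OF u] in eventually_elim)
      fix x assume "x \<notin> \<Omega> \<longrightarrow> u x = 0"
      then show "indicator (ball p 1) x * u x = 0"
        using far[of x] R by (auto simp: indicator_def)
    qed
  next
    fix x y :: "real^'n" assume x: "x \<in> ball 0 R" and y: "y \<in> ball p 1" and "x \<noteq> y"
    have "norm (x - y) \<le> norm x + norm p + norm (p - y)"
      by (smt (verit) norm_triangle_ineq4 norm_triangle_sub norm_minus_commute)
    then have "norm (x - y) \<le> 2 * R + 3"
      using x y p by (simp add: dist_norm)
    then show "c \<le> K (x - y)"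
      unfolding c_def using \<open>x \<noteq> y\<close> by (intro kernel_ge_on_bounded) auto
  qed (use u R b c emeasure_bounded_finite[of "ball p 1"] in \<open>auto simp: b_def disjoint_family_on_def\<close>)
  then show thesis
    using that[of "c * b"] c b by simp
qed

text \<open>
  The cells are fibres of a map into integer vectors, so they are half-open cubes of side \<open>h\<close> and
  automatically disjoint.
\<close>
lemma grid_cell_measure:
  fixes z :: "'n \<Rightarrow> int"
  assumes h: "h > 0"
  defines "C \<equiv> {x::real^'n. (\<lambda>i. \<lfloor>x $ i / h\<rfloor>) = z}"
  shows "C \<in> sets borel" "emeasure lborel C < \<infinity>" "h ^ CARD('n) \<le> measure lborel C"
    and "x \<in> C \<Longrightarrow> y \<in> C \<Longrightarrow> norm (x - y) \<le> real CARD('n) * h"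
proof -
  have C: "C = {x. \<forall>i. \<lfloor>x $ i / h\<rfloor> = z i}" by (auto simp: C_def)
  have mem: "x \<in> C \<longleftrightarrow> (\<forall>i. h * of_int (z i) \<le> x $ i \<and> x $ i < h * (of_int (z i) + 1))" for x
    unfolding C using h by (simp add: floor_eq_iff field_simps)
  show bm: "C \<in> sets borel"
    unfolding C by measurable
  let ?l = "\<chi> i. h * of_int (z i) :: real^'n" and ?r = "\<chi> i. h * (of_int (z i) + 1) :: real^'n"
  have "C \<subseteq> cbox ?l ?r"
    by (auto simp: mem mem_box_cart less_imp_le)
  then show fin: "emeasure lborel C < \<infinity>"
    by (intro emeasure_bounded_finite bounded_subset[OF bounded_cbox])
  have sub: "box ?l ?r \<subseteq> C"
    by (auto simp: mem mem_box_cart less_imp_le)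
  have rl: "(?r - ?l) \<bullet> b = h" if "b \<in> Basis" for b
    using that by (auto simp: Basis_vec_def inner_axis algebra_simps)
  have "emeasure lborel (box ?l ?r) = ennreal (\<Prod>b\<in>Basis. (?r - ?l) \<bullet> b)"
  proof (rule emeasure_lborel_box)
    fix b :: "real^'n" assume "b \<in> Basis"
    then show "?l \<bullet> b \<le> ?r \<bullet> b" using rl[of b] h by (simp add: inner_diff_left)
  qed
  also have "(\<Prod>b\<in>Basis. (?r - ?l) \<bullet> b) = h ^ CARD('n)"
    using rl by simp
  finally have "measure lborel (box ?l ?r) = h ^ CARD('n)"
    using h by (simp add: measure_def)
  moreover have "measure lborel (box ?l ?r) \<le> measure lborel C"
    by (rule measure_mono_fmeasurable[OF sub]) (use bm fin in \<open>auto simp: fmeasurable_def\<close>)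
  ultimately show "h ^ CARD('n) \<le> measure lborel C" by simp
  assume x: "x \<in> C" and y: "y \<in> C"
  have "norm (x - y) \<le> (\<Sum>i\<in>UNIV. \<bar>(x - y) $ i\<bar>)"
    by (rule norm_le_l1_cart)
  also have "\<dots> \<le> (\<Sum>i\<in>(UNIV :: 'n set). h)"
  proof (rule sum_mono)
    fix i
    have "h * of_int (z i) \<le> x $ i" "x $ i < h * of_int (z i) + h" "h * of_int (z i) \<le> y $ i" "y $ i < h * of_int (z i) + h"
      using x y by (auto simp: mem distrib_left)
    then show "\<bar>(x - y) $ i\<bar> \<le> h" by simp
  qed
  finally show "norm (x - y) \<le> real CARD('n) * h" by simp
qed

text \<open>
  The quantitative compactness statement: on a subspace of finite codimension, the energy
  dominates an arbitrarily large multiple of the squared \<open>L\<^sup>2\<close> norm. On a grid of side \<open>h\<close> the factor is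
  \<open>h\<^sup>N\<close> times the infimum of \<open>K\<close> at distances within a cell, which is at least a constant times \<open>h\<^bsup>-2s\<^esup>\<close>.
\<close>
lemma finite_averages_control:
  obtains J :: "('n \<Rightarrow> int) set" and C where "finite J"
    "\<And>j. j \<in> J \<Longrightarrow> C j \<in> sets borel \<and> emeasure lborel (C j) < \<infinity>"
    "\<And>u. u \<in> X \<Longrightarrow> (\<And>j. j \<in> J \<Longrightarrow> (LINT x|lebesgue. indicator (C j) x * u x) = 0) \<Longrightarrow>
       M * (LINT x|lebesgue. (u x)\<^sup>2) \<le> E u u"
proof -
  let ?p = "real CARD('n) + 2 * s"
  define q where "q = \<alpha> * real CARD('n) powr (- ?p)"
  have q: "q > 0" using alpha_pos by (simp add: q_def)
  \<comment> \<open>Chosen so that \<open>q h\<^bsup>-2s\<^esup> = |M| + 1\<close>.\<close>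
  define h where "h = ((\<bar>M\<bar> + 1) / q) powr (- 1 / (2 * s))"
  have h: "h > 0" unfolding h_def using q by simp
  have hs: "h powr (- (2 * s)) = (\<bar>M\<bar> + 1) / q"
    unfolding h_def powr_powr using s_pos q by simp
  define g where "g x = (\<lambda>i. \<lfloor>x $ i / h\<rfloor>)" for x :: "real^'n"
  define C where "C z = {x. g x = z}" for z
  define c where "c = \<alpha> * (real CARD('n) * h) powr (- ?p)"
  obtain R where R: "\<And>x. x \<in> \<Omega> \<Longrightarrow> norm x \<le> R"
    using bounded_domain by (auto simp: bounded_iff)
  define J where "J = g ` \<Omega>"
  have "J \<subseteq> PiE UNIV (\<lambda>_. {\<lfloor>- R / h\<rfloor>..\<lfloor>R / h\<rfloor>})"
  proof -
    have "\<lfloor>- R / h\<rfloor> \<le> \<lfloor>x $ i / h\<rfloor> \<and> \<lfloor>x $ i / h\<rfloor> \<le> \<lfloor>R / h\<rfloor>" if "x \<in> \<Omega>" for x i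
    proof -
      have "\<bar>x $ i\<bar> \<le> R" using R[OF that] component_le_norm_cart[of x i] by simp
      then have "- R / h \<le> x $ i / h" "x $ i / h \<le> R / h"
        using h divide_right_mono[of "- R" "x $ i" h] divide_right_mono[of "x $ i" R h] by simp_all
      then show ?thesis by (simp add: floor_mono)
    qed
    then show ?thesis by (auto simp: J_def g_def PiE_iff)
  qed
  then have J: "finite J"
    by (rule finite_subset) (intro finite_PiE; simp)
  note cell = grid_cell_measure[OF h, folded g_def, folded C_def]
  have cb: "c * h ^ CARD('n) = \<bar>M\<bar> + 1"
  proof -
    have "c * h ^ CARD('n) = q * (h powr (- ?p) * h powr (real CARD('n)))"
      unfolding c_def q_def using h by (simp add: powr_mult powr_realpow)
    also have "h powr (- ?p) * h powr (real CARD('n)) = h powr (- (2 * s))"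
      by (simp add: powr_add[symmetric])
    finally show ?thesis using hs q by simp
  qed
  have c: "c \<ge> 0" using alpha_pos by (simp add: c_def)
  have ctrl: "M * (LINT x|lebesgue. (u x)\<^sup>2) \<le> E u u"
    if u: "u \<in> X" and mean: "\<And>j. j \<in> J \<Longrightarrow> (LINT x|lebesgue. indicator (C j) x * u x) = 0" for u
  proof -
    have "c * h ^ CARD('n) * (LINT x|lebesgue. (u x)\<^sup>2) \<le> E u u"
    proof (rule energy_controls_L2[OF u J, where A = C and B = C])
      show "disjoint_family_on C J" by (auto simp: disjoint_family_on_def C_def)
      show "\<Omega> \<subseteq> (\<Union>i\<in>J. C i)" by (auto simp: J_def C_def)
      fix j x y assume "x \<in> C j" "y \<in> C j" "x \<noteq> y"
      then show "c \<le> K (x - y)"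
        unfolding c_def using cell(4)[of x j y] by (intro kernel_ge_on_bounded) auto
    qed (use cell(1-3) mean c h in auto)
    moreover have "M * (LINT x|lebesgue. (u x)\<^sup>2) \<le> (\<bar>M\<bar> + 1) * (LINT x|lebesgue. (u x)\<^sup>2)"
      by (rule mult_right_mono) (auto intro: integral_nonneg_AE)
    ultimately show ?thesis using cb by simp
  qed
  show thesis
    by (rule that[OF J, of C]) (use cell ctrl in auto)
qed

lemma E_pos:
  assumes u: "u \<in> X" and nz: "\<not> (AE x in lebesgue. u x = 0)"
  shows "0 < E u u"
proof (rule ccontr)
  assume "\<not> 0 < E u u"
  moreover obtain c where c: "c > 0" "c * (LINT x|lebesgue. (u x)\<^sup>2) \<le> E u u"
    using poincare u by metis
  moreover have "0 \<le> (LINT x|lebesgue. (u x)\<^sup>2)" by (simp add: integral_nonneg_AE)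
  ultimately have "(LINT x|lebesgue. (u x)\<^sup>2) = 0"
    by (smt (verit) mult_pos_pos)
  then have "AE x in lebesgue. (u x)\<^sup>2 = 0"
    using X_square_integrable[OF u] by (subst (asm) integral_nonneg_eq_0_iff_AE) auto
  with nz show False by simp
qed

section \<open>The weighted form and finite-dimensional subspaces\<close>

definition weighted_form :: "(real^'n \<Rightarrow> real) \<Rightarrow> (real^'n \<Rightarrow> real) \<Rightarrow> (real^'n \<Rightarrow> real) \<Rightarrow> real" where
  "weighted_form \<rho> u v = (LINT x|lebesgue_on \<Omega>. \<rho> x * u x * v x)"

lemma domain_lebesgue [simp]: "\<Omega> \<in> sets lebesgue"
  using open_domain by auto

lemma AE_domain: "(AE x in lebesgue. P x) \<Longrightarrow> (AE x in lebesgue_on \<Omega>. P x)"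
  by (subst AE_restrict_space_iff) auto

lemma X_measurable_domain: "u \<in> X \<Longrightarrow> u \<in> borel_measurable (lebesgue_on \<Omega>)"
  by (intro measurable_restrict_space1 X_measurable)

lemma X_square_integrable_domain: "u \<in> X \<Longrightarrow> integrable (lebesgue_on \<Omega>) (\<lambda>x. (u x)\<^sup>2)"
  using integrable_mult_indicator[OF domain_lebesgue X_square_integrable]
  by (subst integrable_restrict_space) auto

lemma L2_domain_le:
  assumes "u \<in> X"
  shows "(LINT x|lebesgue_on \<Omega>. (u x)\<^sup>2) \<le> (LINT x|lebesgue. (u x)\<^sup>2)"
proof -
  have "(LINT x|lebesgue_on \<Omega>. (u x)\<^sup>2) = (LINT x|lebesgue. indicator \<Omega> x *\<^sub>R (u x)\<^sup>2)"
    by (rule integral_restrict_space) simp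
  also have "\<dots> \<le> (LINT x|lebesgue. (u x)\<^sup>2)"
    using X_square_integrable[OF assms]
    by (intro integral_mono integrable_mult_indicator) (auto simp: indicator_def)
  finally show ?thesis .
qed

lemma weighted_form_integrable:
  assumes "\<rho> \<in> L_infinity \<Omega>" "u \<in> X" "v \<in> X"
  shows "integrable (lebesgue_on \<Omega>) (\<lambda>x. \<rho> x * u x * v x)"
proof -
  obtain C where C: "AE x in lebesgue_on \<Omega>. \<bar>\<rho> x\<bar> \<le> C" and [measurable]: "\<rho> \<in> borel_measurable (lebesgue_on \<Omega>)"
    using assms(1) by (auto simp: L_infinity_def)
  have [measurable]: "u \<in> borel_measurable (lebesgue_on \<Omega>)" "v \<in> borel_measurable (lebesgue_on \<Omega>)"
    using assms X_measurable_domain by auto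
  show ?thesis
  proof (rule Bochner_Integration.integrable_bound)
    show "integrable (lebesgue_on \<Omega>) (\<lambda>x. C * ((u x)\<^sup>2 + (v x)\<^sup>2))"
      using assms by (intro integrable_mult_right Bochner_Integration.integrable_add X_square_integrable_domain)
    show "AE x in lebesgue_on \<Omega>. norm (\<rho> x * u x * v x) \<le> norm (C * ((u x)\<^sup>2 + (v x)\<^sup>2))"
      using C
    proof eventually_elim
      fix x assume *: "\<bar>\<rho> x\<bar> \<le> C"
      have "\<bar>u x\<bar> * \<bar>v x\<bar> \<le> (u x)\<^sup>2 + (v x)\<^sup>2"
        using abs_mult_le_sum_squares[of "u x" "v x"] by (simp add: abs_mult)
      then have "\<bar>\<rho> x\<bar> * (\<bar>u x\<bar> * \<bar>v x\<bar>) \<le> \<bar>C\<bar> * ((u x)\<^sup>2 + (v x)\<^sup>2)"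
        using * by (intro mult_mono) auto
      then show "norm (\<rho> x * u x * v x) \<le> norm (C * ((u x)\<^sup>2 + (v x)\<^sup>2))"
        by (simp add: abs_mult mult.assoc)
    qed
  qed measurable
qed

lemma weighted_form_expand:
  assumes \<rho>: "\<rho> \<in> L_infinity \<Omega>" and u: "u \<in> X" and v: "v \<in> X"
  shows "weighted_form \<rho> (\<lambda>x. u x + c * v x) (\<lambda>x. u x + c * v x) = weighted_form \<rho> u u + 2 * c * weighted_form \<rho> u v + c\<^sup>2 * weighted_form \<rho> v v"
proof -
  have eq: "\<rho> x * (u x + c * v x) * (u x + c * v x)
     = \<rho> x * u x * u x + 2 * c * (\<rho> x * u x * v x) + c\<^sup>2 * (\<rho> x * v x * v x)" for x
    by (simp add: power2_eq_square algebra_simps)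
  show ?thesis
    unfolding weighted_form_def eq using weighted_form_integrable[OF \<rho> u u] weighted_form_integrable[OF \<rho> u v] weighted_form_integrable[OF \<rho> v v]
    by simp
qed

lemma weighted_form_commute: "weighted_form \<rho> u v = weighted_form \<rho> v u"
  unfolding weighted_form_def by (simp add: mult_ac)

lemma weighted_form_scaled: "weighted_form \<rho> (\<lambda>x. c * u x) (\<lambda>x. c * u x) = c\<^sup>2 * weighted_form \<rho> u u"
proof -
  have eq: "\<rho> x * (c * u x) * (c * u x) = c\<^sup>2 * (\<rho> x * u x * u x)" for x
    by (simp add: power2_eq_square mult_ac)
  show ?thesis unfolding weighted_form_def eq by simp
qed

lemma weighted_form_cong_AE:
  assumes "\<rho> \<in> L_infinity \<Omega>" "u \<in> X" "v \<in> X" "AE x in lebesgue. u x = v x"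
  shows "weighted_form \<rho> u u = weighted_form \<rho> v v"
  unfolding weighted_form_def using assms
  by (intro integral_cong_AE borel_measurable_integrable weighted_form_integrable) (auto dest!: AE_domain)

lemma weighted_form_mono_weight:
  assumes "\<rho> \<in> L_infinity \<Omega>" "\<rho>' \<in> L_infinity \<Omega>" "u \<in> X" "AE x in lebesgue_on \<Omega>. \<rho> x \<le> \<rho>' x"
  shows "weighted_form \<rho> u u \<le> weighted_form \<rho>' u u"
  unfolding weighted_form_def
proof (rule integral_mono_AE)
  show "AE x in lebesgue_on \<Omega>. \<rho> x * u x * u x \<le> \<rho>' x * u x * u x"
    using assms(4) by eventually_elim (simp add: mult.assoc mult_right_mono)
qed (use assms in \<open>auto intro: weighted_form_integrable\<close>)

lemma weighted_form_add_constant_bound: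
  assumes \<rho>: "\<rho> \<in> L_infinity \<Omega>" "\<rho>' \<in> L_infinity \<Omega>" and u: "u \<in> X" and \<epsilon>: "\<epsilon> \<ge> 0"
    and le: "AE x in lebesgue_on \<Omega>. \<rho>' x \<le> \<rho> x + \<epsilon>"
  shows "weighted_form \<rho>' u u \<le> weighted_form \<rho> u u + \<epsilon> * (LINT x|lebesgue. (u x)\<^sup>2)"
proof -
  have "weighted_form \<rho>' u u \<le> (LINT x|lebesgue_on \<Omega>. \<rho> x * u x * u x + \<epsilon> * (u x)\<^sup>2)"
    unfolding weighted_form_def
  proof (rule integral_mono_AE)
    show "AE x in lebesgue_on \<Omega>. \<rho>' x * u x * u x \<le> \<rho> x * u x * u x + \<epsilon> * (u x)\<^sup>2"
      using le
    proof eventually_elim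
      fix x assume "\<rho>' x \<le> \<rho> x + \<epsilon>"
      then have "\<rho>' x * (u x)\<^sup>2 \<le> (\<rho> x + \<epsilon>) * (u x)\<^sup>2" by (rule mult_right_mono) simp
      then show "\<rho>' x * u x * u x \<le> \<rho> x * u x * u x + \<epsilon> * (u x)\<^sup>2"
        by (simp add: power2_eq_square algebra_simps)
    qed
  qed (use \<rho> u in \<open>auto intro!: weighted_form_integrable integrable_add integrable_mult_right X_square_integrable_domain\<close>)
  also have "\<dots> = weighted_form \<rho> u u + \<epsilon> * (LINT x|lebesgue_on \<Omega>. (u x)\<^sup>2)"
    unfolding weighted_form_def using weighted_form_integrable[OF \<rho>(1) u u] X_square_integrable_domain[OF u] by simp
  also have "\<dots> \<le> weighted_form \<rho> u u + \<epsilon> * (LINT x|lebesgue. (u x)\<^sup>2)"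
    using L2_domain_le[OF u] \<epsilon> by (simp add: mult_left_mono)
  finally show ?thesis .
qed

lemma L_infinity_zero: "(\<lambda>_. 0) \<in> L_infinity \<Omega>"
  by (auto simp: L_infinity_def)

lemma weighted_form_bounds:
  assumes \<rho>: "\<rho> \<in> L_infinity \<Omega>"
  obtains C where "C > 0" "\<And>u. u \<in> X \<Longrightarrow> weighted_form \<rho> u u \<le> C * (LINT x|lebesgue. (u x)\<^sup>2)"
    "\<And>u. u \<in> X \<Longrightarrow> - C * (LINT x|lebesgue. (u x)\<^sup>2) \<le> weighted_form \<rho> u u"
proof -
  obtain C where C: "AE x in lebesgue_on \<Omega>. \<bar>\<rho> x\<bar> \<le> C"
    using \<rho> by (auto simp: L_infinity_def)
  have "weighted_form \<rho> u u \<le> (\<bar>C\<bar> + 1) * (LINT x|lebesgue. (u x)\<^sup>2)" if u: "u \<in> X" for u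
  proof -
    have "AE x in lebesgue_on \<Omega>. \<rho> x \<le> 0 + (\<bar>C\<bar> + 1)" using C by eventually_elim auto
    from weighted_form_add_constant_bound[OF L_infinity_zero \<rho> u _ this] show ?thesis
      by (simp add: weighted_form_def)
  qed
  moreover have "- (\<bar>C\<bar> + 1) * (LINT x|lebesgue. (u x)\<^sup>2) \<le> weighted_form \<rho> u u" if u: "u \<in> X" for u
  proof -
    have "AE x in lebesgue_on \<Omega>. 0 \<le> \<rho> x + (\<bar>C\<bar> + 1)" using C by eventually_elim auto
    from weighted_form_add_constant_bound[OF \<rho> L_infinity_zero u _ this]
    have "0 \<le> weighted_form \<rho> u u + (\<bar>C\<bar> + 1) * (LINT x|lebesgue. (u x)\<^sup>2)"
      by (simp add: weighted_form_def)
    then show ?thesis unfolding mult_minus_left by linarith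
  qed
  ultimately show thesis using that[of "\<bar>C\<bar> + 1"] by simp
qed

abbreviation S :: "nat \<Rightarrow> (real^'n \<Rightarrow> real) set set" where "S \<equiv> subspaces_K K \<Omega>"

lemma S_subset: "F \<in> S k \<Longrightarrow> u \<in> F \<Longrightarrow> u \<in> X"
  by (auto simp: subspaces_K_def)

lemma S_scaled:
  assumes "F \<in> S k" "u \<in> F"
  shows "(\<lambda>x. t * u x) \<in> F"
proof -
  from assms(1) obtain b where F: "F = {v \<in> X. \<exists>c::nat \<Rightarrow> real. AE x in lebesgue. v x = (\<Sum>i<k. c i * b i x)}"
    by (auto simp: subspaces_K_def)
  with assms(2) obtain c :: "nat \<Rightarrow> real" where u: "u \<in> X" and c: "AE x in lebesgue. u x = (\<Sum>i<k. c i * b i x)"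
    by auto
  from c have "AE x in lebesgue. t * u x = (\<Sum>i<k. (t * c i) * b i x)"
    by eventually_elim (simp add: sum_distrib_left mult.assoc)
  then show ?thesis
    unfolding F using X_scaled[OF u, of t] by (auto intro!: exI[of _ "\<lambda>i. t * c i"])
qed

lemma S_zero: "{v \<in> X. AE x in lebesgue. v x = 0} \<in> S 0"
  by (auto simp: subspaces_K_def)

lemma S_extend:
  assumes F: "F \<in> S k" and u: "u \<in> X" "u \<notin> F"
  shows "{v \<in> X. \<exists>w\<in>F. \<exists>c. AE x in lebesgue. v x = w x + c * u x} \<in> S (Suc k)" (is "?G \<in> _")
proof -
  from F obtain b where b: "\<And>i. i < k \<Longrightarrow> b i \<in> X"
    and indep: "\<And>c::nat \<Rightarrow> real. (AE x in lebesgue. (\<Sum>i<k. c i * b i x) = 0) \<Longrightarrow> (\<forall>i<k. c i = 0)"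
    and Feq: "F = {v \<in> X. \<exists>c::nat \<Rightarrow> real. AE x in lebesgue. v x = (\<Sum>i<k. c i * b i x)}"
    by (auto simp: subspaces_K_def)
  define b' where "b' i = (if i < k then b i else u)" for i
  have sum_b': "(\<Sum>i<Suc k. c i * b' i x) = (\<Sum>i<k. c i * b i x) + c k * u x" for c :: "nat \<Rightarrow> real" and x
    by (simp add: b'_def)
  have "\<forall>i<Suc k. b' i \<in> X" using b u by (simp add: b'_def)
  moreover have "\<forall>i<Suc k. c i = 0" if c: "AE x in lebesgue. (\<Sum>i<Suc k. c i * b' i x) = 0" for c :: "nat \<Rightarrow> real"
  proof -
    have "c k = 0"
    proof (rule ccontr)
      assume nz: "c k \<noteq> 0"
      have "AE x in lebesgue. u x = (\<Sum>i<k. (- c i / c k) * b i x)"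
        using c
      proof eventually_elim
        fix x assume "(\<Sum>i<Suc k. c i * b' i x) = 0"
        then have "u x = (- 1 / c k) * (\<Sum>i<k. c i * b i x)"
          using nz unfolding sum_b' by (simp add: field_simps add_eq_0_iff)
        then show "u x = (\<Sum>i<k. (- c i / c k) * b i x)"
          by (simp only: sum_distrib_left) (simp add: sum_negf)
      qed
      then have "u \<in> F"
        unfolding Feq using u(1) by (intro CollectI conjI exI[of _ "\<lambda>i. - c i / c k"])
      with u(2) show False by simp
    qed
    moreover from c this have "\<forall>i<k. c i = 0"
      by (intro indep) (simp add: sum_b' del: sum.lessThan_Suc)
    ultimately show ?thesis by (auto simp: less_Suc_eq)
  qed
  moreover have "?G = {v \<in> X. \<exists>c::nat \<Rightarrow> real. AE x in lebesgue. v x = (\<Sum>i<Suc k. c i * b' i x)}" (is "_ = ?H")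
  proof (intro set_eqI iffI)
    fix v assume "v \<in> ?G"
    then obtain w c where v: "v \<in> X" "w \<in> F" and vw: "AE x in lebesgue. v x = w x + c * u x" by auto
    then obtain d :: "nat \<Rightarrow> real" where d: "AE x in lebesgue. w x = (\<Sum>i<k. d i * b i x)" by (auto simp: Feq)
    have "AE x in lebesgue. v x = (\<Sum>i<Suc k. (d(k := c)) i * b' i x)"
      unfolding sum_b' using vw d by eventually_elim simp
    then show "v \<in> ?H" using v by blast
  next
    fix v assume "v \<in> ?H"
    then obtain c :: "nat \<Rightarrow> real" where v: "v \<in> X" and c: "AE x in lebesgue. v x = (\<Sum>i<k. c i * b i x) + c k * u x"
      by (auto simp: sum_b' simp del: sum.lessThan_Suc)
    have "(\<lambda>x. \<Sum>i<k. c i * b i x) \<in> F"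
      unfolding Feq using X_sum[of k b c] b by (intro CollectI conjI exI[of _ c]) auto
    then show "v \<in> ?G"
      using v c by (intro CollectI conjI bexI[of _ "\<lambda>x. \<Sum>i<k. c i * b i x"] exI[of _ "c k"])
  qed
  ultimately show ?thesis
    unfolding subspaces_K_def by blast
qed

text \<open>
  A subspace of dimension exceeding the number of averages contains a nonzero function all of whose
  averages vanish, and for it the energy dominates the weighted form. Consequently the
  max-min values of high index are small.
\<close>
lemma finite_dim_small_quotient:
  assumes \<rho>: "\<rho> \<in> L_infinity \<Omega>" and t: "t > 0"
  obtains m where "\<And>k F. m < k \<Longrightarrow> F \<in> S k \<Longrightarrow> \<exists>u\<in>F. weighted_form \<rho> u u < t * E u u"
proof -
  obtain C where C: "C > 0" "\<And>u. u \<in> X \<Longrightarrow> weighted_form \<rho> u u \<le> C * (LINT x|lebesgue. (u x)\<^sup>2)"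
    using weighted_form_bounds[OF \<rho>] by metis
  obtain J :: "('n \<Rightarrow> int) set" and A where J: "finite J"
    and A: "\<And>j. j \<in> J \<Longrightarrow> A j \<in> sets borel \<and> emeasure lborel (A j) < \<infinity>"
    and ctrl: "\<And>u. u \<in> X \<Longrightarrow> (\<And>j. j \<in> J \<Longrightarrow> (LINT x|lebesgue. indicator (A j) x * u x) = 0) \<Longrightarrow>
       (2 * C / t) * (LINT x|lebesgue. (u x)\<^sup>2) \<le> E u u"
    using finite_averages_control[of "2 * C / t"] by blast
  have int: "integrable lebesgue (\<lambda>x. indicator (A j) x * u x)" if j: "j \<in> J" and u: "u \<in> X" for j u
    using A[OF j] X_measurable[OF u] X_square_integrable[OF u] by (intro integrable_indicator_mult) auto
  have "\<exists>u\<in>F. weighted_form \<rho> u u < t * E u u" if k: "card J < k" and F: "F \<in> S k" for k F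
  proof -
    from F obtain b where b: "\<And>i. i < k \<Longrightarrow> b i \<in> X"
      and indep: "\<And>c::nat \<Rightarrow> real. (AE x in lebesgue. (\<Sum>i<k. c i * b i x) = 0) \<Longrightarrow> (\<forall>i<k. c i = 0)"
      and Feq: "F = {v \<in> X. \<exists>c::nat \<Rightarrow> real. AE x in lebesgue. v x = (\<Sum>i<k. c i * b i x)}"
      by (auto simp: subspaces_K_def)
    obtain c where c: "\<exists>i\<in>{..<k}. c i \<noteq> 0"
      "\<forall>j\<in>J. (\<Sum>i<k. c i * (LINT x|lebesgue. indicator (A j) x * b i x)) = 0"
      using homogeneous_system_nontrivial_solution[OF J, of "{..<k}" "\<lambda>i j. LINT x|lebesgue. indicator (A j) x * b i x"] k
      by auto
    let ?u = "\<lambda>x. \<Sum>i<k. c i * b i x"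
    have u: "?u \<in> X" using b by (rule X_sum)
    then have "?u \<in> F" unfolding Feq by (intro CollectI conjI exI[of _ c]) auto
    have "\<not> (AE x in lebesgue. ?u x = 0)" using indep c(1) by blast
    then have pos: "0 < E ?u ?u" by (rule E_pos[OF u])
    have "(LINT x|lebesgue. indicator (A j) x * ?u x) = 0" if j: "j \<in> J" for j
    proof -
      have "(LINT x|lebesgue. indicator (A j) x * ?u x) = (LINT x|lebesgue. (\<Sum>i<k. c i * (indicator (A j) x * b i x)))"
        by (simp add: sum_distrib_left mult.left_commute)
      also have "\<dots> = (\<Sum>i<k. c i * (LINT x|lebesgue. indicator (A j) x * b i x))"
        using int[OF j b] by (subst Bochner_Integration.integral_sum) auto
      finally show ?thesis using c(2) j by simp
    qed
    from ctrl[OF u this] have "2 * (C * (LINT x|lebesgue. (?u x)\<^sup>2)) \<le> t * E ?u ?u"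
      using t by (simp add: field_simps)
    moreover have "0 < t * E ?u ?u" using t pos by simp
    ultimately have "weighted_form \<rho> ?u ?u < t * E ?u ?u"
      using C(2)[OF u] by linarith
    with \<open>?u \<in> F\<close> show ?thesis by blast
  qed
  then show thesis by (rule that)
qed

section \<open>Max-min values under perturbation of the weight\<close>

definition sphere_inf :: "(real^'n \<Rightarrow> real) \<Rightarrow> (real^'n \<Rightarrow> real) set \<Rightarrow> real" where
  "sphere_inf \<rho> F = (INF u\<in>{u \<in> F. norm_K K u = 1}. weighted_form \<rho> u u)"

definition maxmin :: "(real^'n \<Rightarrow> real) \<Rightarrow> nat \<Rightarrow> real" where
  "maxmin \<rho> k = (SUP F\<in>S k. sphere_inf \<rho> F)"

lemma eigval_eq_maxmin: "k > 0 \<Longrightarrow> eigval K \<Omega> \<rho> (int k) = inverse (maxmin \<rho> k)"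
  unfolding eigval_def maxmin_def sphere_inf_def weighted_form_def power2_eq_square mult.assoc by simp

lemma unit_multiple:
  assumes "F \<in> S k" "u \<in> F" "0 < E u u"
  shows "\<exists>v\<in>F. norm_K K v = 1 \<and> weighted_form \<rho> u u = E u u * weighted_form \<rho> v v"
proof -
  let ?v = "\<lambda>x. (1 / sqrt (E u u)) * u x"
  have "?v \<in> F" by (rule S_scaled[OF assms(1,2)])
  moreover have "E ?v ?v = 1"
    using assms E_scaled[OF S_subset[OF assms(1,2)], of "1 / sqrt (E u u)"]
    by (simp add: power_divide)
  moreover have "weighted_form \<rho> u u = E u u * weighted_form \<rho> ?v ?v"
    using assms weighted_form_scaled[of \<rho> "1 / sqrt (E u u)" u] by (simp add: power_divide)
  ultimately show ?thesis by (auto simp: norm_K_eq intro!: bexI[of _ ?v])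
qed

lemma S_nontrivial:
  assumes F: "F \<in> S k" and k: "k > 0"
  obtains u where "u \<in> F" "0 < E u u"
proof -
  from F obtain b where b: "\<And>i. i < k \<Longrightarrow> b i \<in> X"
    and indep: "\<And>c::nat \<Rightarrow> real. (AE x in lebesgue. (\<Sum>i<k. c i * b i x) = 0) \<Longrightarrow> (\<forall>i<k. c i = 0)"
    and Feq: "F = {v \<in> X. \<exists>c::nat \<Rightarrow> real. AE x in lebesgue. v x = (\<Sum>i<k. c i * b i x)}"
    by (auto simp: subspaces_K_def)
  let ?c = "\<lambda>i. if i = 0 then 1 else 0 :: real"
  have eq: "(\<Sum>i<k. ?c i * b i x) = b 0 x" for x
    using k by (subst sum.remove[of _ 0]) auto
  have "b 0 \<in> F"
    unfolding Feq using b k by (intro CollectI conjI exI[of _ ?c]) (auto simp: eq)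
  moreover have "\<not> (AE x in lebesgue. b 0 x = 0)"
  proof
    assume "AE x in lebesgue. b 0 x = 0"
    then have "\<forall>i<k. ?c i = 0" by (intro indep) (simp add: eq)
    from this[rule_format, OF k] show False by simp
  qed
  ultimately show thesis
    using E_pos[OF b[OF k]] that[of "b 0"] by simp
qed

lemma weighted_form_bounded_on_sphere:
  assumes "\<rho> \<in> L_infinity \<Omega>"
  shows "\<exists>C. \<forall>u\<in>X. norm_K K u = 1 \<longrightarrow> \<bar>weighted_form \<rho> u u\<bar> \<le> C"
proof -
  obtain C where C: "C > 0" "\<And>u. u \<in> X \<Longrightarrow> weighted_form \<rho> u u \<le> C * (LINT x|lebesgue. (u x)\<^sup>2)"
    "\<And>u. u \<in> X \<Longrightarrow> - C * (LINT x|lebesgue. (u x)\<^sup>2) \<le> weighted_form \<rho> u u"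
    using weighted_form_bounds[OF assms] by metis
  obtain c where c: "c > 0" "\<And>u. u \<in> X \<Longrightarrow> c * (LINT x|lebesgue. (u x)\<^sup>2) \<le> E u u"
    using poincare by metis
  have "\<bar>weighted_form \<rho> u u\<bar> \<le> C * (1 / c)" if u: "u \<in> X" and "norm_K K u = 1" for u
  proof -
    have "c * (LINT x|lebesgue. (u x)\<^sup>2) \<le> 1"
      using c(2)[OF u] that by (simp add: norm_K_eq)
    then have "C * (LINT x|lebesgue. (u x)\<^sup>2) \<le> C * (1 / c)"
      using c(1) C(1) by (intro mult_left_mono) (auto simp: field_simps)
    then show ?thesis using C(2,3)[OF u] by (simp add: abs_le_iff)
  qed
  then show ?thesis by blast
qed

lemma sphere_inf_mult_le:
  assumes \<rho>: "\<rho> \<in> L_infinity \<Omega>" and F: "F \<in> S k" and u: "u \<in> F"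
  shows "sphere_inf \<rho> F * E u u \<le> weighted_form \<rho> u u"
proof (cases "0 < E u u")
  case True
  obtain C where C: "\<And>u. u \<in> X \<Longrightarrow> norm_K K u = 1 \<Longrightarrow> \<bar>weighted_form \<rho> u u\<bar> \<le> C"
    using weighted_form_bounded_on_sphere[OF \<rho>] by blast
  obtain v where v: "v \<in> F" "norm_K K v = 1" "weighted_form \<rho> u u = E u u * weighted_form \<rho> v v"
    using unit_multiple[OF F u True] by metis
  have "bdd_below ((\<lambda>u. weighted_form \<rho> u u) ` {u \<in> F. norm_K K u = 1})"
    using C S_subset[OF F] by (intro bdd_belowI2[of _ "- C"]) (simp add: abs_le_iff minus_le_iff)
  then have "sphere_inf \<rho> F \<le> weighted_form \<rho> v v"
    unfolding sphere_inf_def using v by (intro cINF_lower) auto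
  then show ?thesis
    using v(3) True by (simp add: mult.commute)
next
  case False
  note uX = S_subset[OF F u]
  have "AE x in lebesgue. u x = 0" using E_pos[OF uX] False by blast
  then have "weighted_form \<rho> u u = 0"
    using weighted_form_cong_AE[OF \<rho> uX X_zero] by (simp add: weighted_form_def)
  moreover have "E u u = 0" using False E_nonneg[of u] by simp
  ultimately show ?thesis by simp
qed

lemma le_sphere_inf:
  assumes F: "F \<in> S k" and k: "k > 0" and le: "\<And>u. u \<in> F \<Longrightarrow> norm_K K u = 1 \<Longrightarrow> t \<le> weighted_form \<rho> u u"
  shows "t \<le> sphere_inf \<rho> F"
proof -
  obtain u where "u \<in> F" "0 < E u u" using S_nontrivial[OF F k] .
  then obtain v where "v \<in> F" "norm_K K v = 1" using unit_multiple[OF F] by metis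
  then show ?thesis
    unfolding sphere_inf_def using le by (intro cINF_greatest) auto
qed

lemma sphere_inf_bdd_above:
  assumes \<rho>: "\<rho> \<in> L_infinity \<Omega>" and k: "k > 0"
  shows "bdd_above (sphere_inf \<rho> ` S k)"
proof -
  obtain C where C: "\<And>u. u \<in> X \<Longrightarrow> norm_K K u = 1 \<Longrightarrow> \<bar>weighted_form \<rho> u u\<bar> \<le> C"
    using weighted_form_bounded_on_sphere[OF \<rho>] by blast
  have "sphere_inf \<rho> F \<le> C" if F: "F \<in> S k" for F
  proof -
    obtain u where "u \<in> F" "0 < E u u" using S_nontrivial[OF F k] .
    then obtain v where v: "v \<in> F" "norm_K K v = 1" using unit_multiple[OF F] by metis
    then have "E v v = 1" by (simp add: norm_K_eq)
    then show ?thesis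
      using sphere_inf_mult_le[OF \<rho> F v(1)] C[OF S_subset[OF F v(1)] v(2)] by simp
  qed
  then show ?thesis by (rule bdd_aboveI2)
qed

lemma maxmin_ge:
  assumes \<rho>: "\<rho> \<in> L_infinity \<Omega>" and k: "k > 0" and F: "F \<in> S k"
    and le: "\<And>u. u \<in> F \<Longrightarrow> t * E u u \<le> weighted_form \<rho> u u"
  shows "t \<le> maxmin \<rho> k"
proof -
  have "t \<le> sphere_inf \<rho> F"
    using le by (intro le_sphere_inf[OF F k]) (force simp: norm_K_eq)
  also have "\<dots> \<le> maxmin \<rho> k"
    unfolding maxmin_def by (rule cSUP_upper[OF F sphere_inf_bdd_above[OF \<rho> k]])
  finally show ?thesis .
qed

text \<open>
  Together with \<open>maxmin_ge\<close> this trades max-min values for lower bounds of the weighted form on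
  subspaces. Strictness leaves room for a constant
  \<open>t' > t\<close>, which makes the form \<open>weighted_form \<rho> - t E\<close> positive definite on \<open>F\<close>.
\<close>
lemma maxmin_gt_witness:
  assumes \<rho>: "\<rho> \<in> L_infinity \<Omega>" and ne: "S k \<noteq> {}" and t: "t < maxmin \<rho> k"
  obtains F t' where "F \<in> S k" "t < t'" "\<And>u. u \<in> F \<Longrightarrow> t' * E u u \<le> weighted_form \<rho> u u"
proof -
  have "\<exists>F\<in>S k. t < sphere_inf \<rho> F"
  proof (rule ccontr)
    assume "\<not> ?thesis"
    then have "sphere_inf \<rho> F \<le> t" if "F \<in> S k" for F
      using that by force
    then have "maxmin \<rho> k \<le> t"
      unfolding maxmin_def by (rule cSUP_least[OF ne])
    with t show False by simp
  qed
  then obtain F where F: "F \<in> S k" "t < sphere_inf \<rho> F" by blast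
  show thesis
    by (rule that[OF F]) (rule sphere_inf_mult_le[OF \<rho> F(1)])
qed

lemma maxmin_mono:
  assumes \<rho>: "\<rho> \<in> L_infinity \<Omega>" "\<rho>' \<in> L_infinity \<Omega>" and le: "AE x in lebesgue_on \<Omega>. \<rho> x \<le> \<rho>' x"
    and k: "k > 0" and ne: "S k \<noteq> {}"
  shows "maxmin \<rho> k \<le> maxmin \<rho>' k"
proof (rule dense_ge)
  fix t assume "maxmin \<rho>' k < t"
  show "maxmin \<rho> k \<le> t"
  proof (rule ccontr)
    assume "\<not> maxmin \<rho> k \<le> t"
    then have "t < maxmin \<rho> k" by simp
    then obtain F t' where F: "F \<in> S k" "t < t'" "\<And>u. u \<in> F \<Longrightarrow> t' * E u u \<le> weighted_form \<rho> u u"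
      using maxmin_gt_witness[OF \<rho>(1) ne] by blast
    have "t' * E u u \<le> weighted_form \<rho>' u u" if "u \<in> F" for u
      using F(3)[OF that] weighted_form_mono_weight[OF \<rho> S_subset[OF F(1) that] le] by linarith
    from maxmin_ge[OF \<rho>(2) k F(1) this] F(2) \<open>maxmin \<rho>' k < t\<close> show False by simp
  qed
qed

text \<open>
  By assumption \<open>u\<close> is in the radical of the form \<open>weighted_form \<rho> - \<mu> E\<close>, so the value of this
  form at \<open>w + c u\<close> is its value at \<open>w\<close>.
\<close>
lemma extend_by_radical:
  assumes \<rho>: "\<rho> \<in> L_infinity \<Omega>" and F: "F \<in> S k" and u: "u \<in> X" "u \<notin> F"
    and rad: "\<And>v. v \<in> X \<Longrightarrow> \<mu> * E u v = weighted_form \<rho> u v"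
    and le: "\<And>w. w \<in> F \<Longrightarrow> \<mu> * E w w \<le> weighted_form \<rho> w w"
  obtains G where "G \<in> S (Suc k)" "\<And>v. v \<in> G \<Longrightarrow> \<mu> * E v v \<le> weighted_form \<rho> v v"
proof (rule that[OF S_extend[OF F u]])
  fix v assume "v \<in> {v \<in> X. \<exists>w\<in>F. \<exists>c. AE x in lebesgue. v x = w x + c * u x}"
  then obtain w c where v: "v \<in> X" and w: "w \<in> F" and eq: "AE x in lebesgue. v x = w x + c * u x" by auto
  have wX: "w \<in> X" by (rule S_subset[OF F w])
  note wuX = X_add_scaled[OF wX u(1), of c]
  have "weighted_form \<rho> v v = weighted_form \<rho> w w + 2 * c * (\<mu> * E u w) + c\<^sup>2 * (\<mu> * E u u)"
    using weighted_form_cong_AE[OF \<rho> v wuX eq] weighted_form_expand[OF \<rho> wX u(1), of c] rad[OF wX] rad[OF u(1)] weighted_form_commute[of \<rho> u w]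
    by simp
  moreover have "\<mu> * E v v = \<mu> * E w w + 2 * c * (\<mu> * E u w) + c\<^sup>2 * (\<mu> * E u u)"
    using E_cong_AE[OF v v wuX wuX eq eq] E_expand(2)[OF wX u(1), of c] E_commute[of u w]
    by (simp add: algebra_simps)
  ultimately show "\<mu> * E v v \<le> weighted_form \<rho> v v" using le[OF w] by linarith
qed

text \<open>
  The heart of the proof. The index \<open>k\<close> is the largest one for which the max-min value still
  reaches \<open>\<mu>\<close>. A larger value for \<open>\<rho>'\<close> would, after adjoining \<open>u\<close>, push the next max-min value of
  \<open>\<rho>\<close> almost up to \<open>\<mu>\<close>, which the choice of \<open>\<epsilon>\<close> excludes.
\<close>
lemma maxmin_stable:
  assumes \<rho>: "\<rho> \<in> L_infinity \<Omega>" and \<mu>: "\<mu> > 0" and u: "u \<in> X" "\<not> (AE x in lebesgue. u x = 0)"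
    and rad: "\<And>v. v \<in> X \<Longrightarrow> \<mu> * E u v = weighted_form \<rho> u v"
  obtains k \<epsilon> where "k > 0" "\<epsilon> > 0"
    "\<And>\<rho>'. \<rho>' \<in> L_infinity \<Omega> \<Longrightarrow> (AE x in lebesgue_on \<Omega>. \<rho> x \<le> \<rho>' x \<and> \<rho>' x \<le> \<rho> x + \<epsilon>) \<Longrightarrow>
        (\<And>v. v \<in> X \<Longrightarrow> weighted_form \<rho>' u v = weighted_form \<rho> u v) \<Longrightarrow> maxmin \<rho>' k = \<mu>"
proof -
  have Eu: "0 < E u u" by (rule E_pos[OF u])
  define P where "P k \<longleftrightarrow> 0 < k \<and> S k \<noteq> {} \<and> \<mu> \<le> maxmin \<rho> k" for k
  \<comment> \<open>The line spanned by \<open>u\<close>, obtained by adjoining \<open>u\<close> to the zero subspace.\<close>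
  have "P 1"
  proof -
    let ?Z = "{v \<in> X. AE x in lebesgue. v x = 0}"
    have "\<mu> * E w w \<le> weighted_form \<rho> w w" if "w \<in> ?Z" for w
      using that weighted_form_cong_AE[OF \<rho> _ X_zero, of w] E_pos[of w] E_cong_AE[of w w "\<lambda>_. 0" "\<lambda>_. 0"] X_zero
      by (simp add: weighted_form_def inner_K_def)
    then obtain G where G: "G \<in> S (Suc 0)" "\<And>v. v \<in> G \<Longrightarrow> \<mu> * E v v \<le> weighted_form \<rho> v v"
      using extend_by_radical[OF \<rho> S_zero u(1) _ rad] u(2) by blast
    then show ?thesis
      using maxmin_ge[OF \<rho> _ G] by (auto simp: P_def)
  qed
  obtain m where m: "\<And>k F. m < k \<Longrightarrow> F \<in> S k \<Longrightarrow> \<exists>u\<in>F. weighted_form \<rho> u u < (\<mu> / 2) * E u u"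
    using finite_dim_small_quotient[OF \<rho>, of "\<mu> / 2"] \<mu> by auto
  have "k \<le> m" if "P k" for k
  proof (rule ccontr)
    assume "\<not> k \<le> m"
    from that \<mu> have "S k \<noteq> {}" "\<mu> / 2 < maxmin \<rho> k" by (auto simp: P_def)
    then obtain F t where F: "F \<in> S k" "\<mu> / 2 < t" "\<And>u. u \<in> F \<Longrightarrow> t * E u u \<le> weighted_form \<rho> u u"
      using maxmin_gt_witness[OF \<rho>] by blast
    obtain w where w: "w \<in> F" "weighted_form \<rho> w w < (\<mu> / 2) * E w w"
      using m[OF _ F(1)] \<open>\<not> k \<le> m\<close> by auto
    have "(\<mu> / 2) * E w w \<le> t * E w w"
      using F(2) E_nonneg[of w] by (intro mult_right_mono) auto
    then show False using w(2) F(3)[OF w(1)] by linarith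
  qed
  then have bound: "\<forall>k. P k \<longrightarrow> k \<le> m" by blast
  define k where "k = Greatest P"
  have Pk: "P k" unfolding k_def by (rule GreatestI_nat[of P 1 m]) (use \<open>P 1\<close> bound in blast)+
  then have k_pos: "0 < k" and k_ne: "S k \<noteq> {}" and k_level: "\<mu> \<le> maxmin \<rho> k"
    by (simp_all add: P_def)
  have "\<not> P (Suc k)"
  proof
    assume "P (Suc k)"
    then have "Suc k \<le> Greatest P" by (rule Greatest_le_nat[of P "Suc k" m]) (use bound in blast)
    then show False by (simp add: k_def)
  qed
  then have next_lt: "S (Suc k) \<noteq> {} \<Longrightarrow> maxmin \<rho> (Suc k) < \<mu>" by (auto simp: P_def)
  \<comment> \<open>The gap below \<open>\<mu>\<close>. If no subspace of dimension \<open>k + 1\<close> exists, the supremum over the empty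
    family has no meaning, and any positive number will do.\<close>
  define \<delta> where "\<delta> = (if S (Suc k) = {} then 1 else \<mu> - maxmin \<rho> (Suc k))"
  have \<delta>: "\<delta> > 0" using next_lt by (simp add: \<delta>_def)
  obtain c where c: "c > 0" "\<And>u. u \<in> X \<Longrightarrow> c * (LINT x|lebesgue. (u x)\<^sup>2) \<le> E u u"
    using poincare by metis
  \<comment> \<open>By Poincare, raising the weight by at most \<open>\<epsilon>\<close> raises the weighted form by at most \<open>(\<delta>/2) E\<close>.\<close>
  define \<epsilon> where "\<epsilon> = c * (\<delta> / 2)"
  have \<epsilon>: "\<epsilon> > 0" using c \<delta> by (simp add: \<epsilon>_def)
  have "maxmin \<rho>' k = \<mu>"
    if \<rho>': "\<rho>' \<in> L_infinity \<Omega>" and ae: "AE x in lebesgue_on \<Omega>. \<rho> x \<le> \<rho>' x \<and> \<rho>' x \<le> \<rho> x + \<epsilon>"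
      and same: "\<And>v. v \<in> X \<Longrightarrow> weighted_form \<rho>' u v = weighted_form \<rho> u v" for \<rho>'
  proof (rule antisym)
    from ae have lo: "AE x in lebesgue_on \<Omega>. \<rho> x \<le> \<rho>' x" by eventually_elim simp
    from ae have hi: "AE x in lebesgue_on \<Omega>. \<rho>' x \<le> \<rho> x + \<epsilon>" by eventually_elim simp
    show "\<mu> \<le> maxmin \<rho>' k"
      using maxmin_mono[OF \<rho> \<rho>' lo k_pos k_ne] k_level by linarith
    have rad': "\<mu> * E u v = weighted_form \<rho>' u v" if "v \<in> X" for v
      using rad[OF that] same[OF that] by simp
    show "maxmin \<rho>' k \<le> \<mu>"
    proof (rule ccontr)
      assume "\<not> maxmin \<rho>' k \<le> \<mu>"
      then have "\<mu> < maxmin \<rho>' k" by simp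
      then obtain F t where F: "F \<in> S k" "\<mu> < t" "\<And>w. w \<in> F \<Longrightarrow> t * E w w \<le> weighted_form \<rho>' w w"
        using maxmin_gt_witness[OF \<rho>' k_ne] by blast
      have "u \<notin> F"
      proof
        assume "u \<in> F"
        then have "t * E u u \<le> \<mu> * E u u" using F(3)[of u] rad'[OF u(1)] by simp
        then show False using F(2) Eu by simp
      qed
      moreover have "\<mu> * E w w \<le> weighted_form \<rho>' w w" if "w \<in> F" for w
        using F(3)[OF that] mult_right_mono[OF less_imp_le[OF F(2)] E_nonneg[of w]] by linarith
      ultimately obtain G where G: "G \<in> S (Suc k)" "\<And>v. v \<in> G \<Longrightarrow> \<mu> * E v v \<le> weighted_form \<rho>' v v"
        using extend_by_radical[OF \<rho>' F(1) u(1) _ rad'] by blast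
      have "(\<mu> - \<delta> / 2) * E v v \<le> weighted_form \<rho> v v" if v: "v \<in> G" for v
      proof -
        note vX = S_subset[OF G(1) v]
        have "weighted_form \<rho>' v v \<le> weighted_form \<rho> v v + \<epsilon> * (LINT x|lebesgue. (v x)\<^sup>2)"
          using weighted_form_add_constant_bound[OF \<rho> \<rho>' vX _ hi] \<epsilon> by simp
        also have "\<epsilon> * (LINT x|lebesgue. (v x)\<^sup>2) \<le> \<delta> / 2 * E v v"
          using mult_left_mono[OF c(2)[OF vX], of "\<delta> / 2"] \<delta> by (simp add: \<epsilon>_def mult_ac)
        finally show ?thesis using G(2)[OF v] by (simp add: left_diff_distrib)
      qed
      then have "\<mu> - \<delta> / 2 \<le> maxmin \<rho> (Suc k)"
        by (intro maxmin_ge[OF \<rho> _ G(1)]) auto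
      moreover have "\<delta> = \<mu> - maxmin \<rho> (Suc k)" using G(1) by (auto simp: \<delta>_def)
      ultimately show False using \<delta> by linarith
    qed
  qed
  then show thesis by (rule that[OF k_pos \<epsilon>])
qed

end

text \<open>
  On the reals \<open>Inf\<close> is defined as the negative of \<open>Sup\<close> of the negated set, so the next two
  identities hold for every family, also where the extrema have no meaning.
  They transfer the statement from positive to negative eigenvalues.
\<close>
lemma INF_uminus_real: "(INF u\<in>A. - f u :: real) = - (SUP u\<in>A. f u)"
  and SUP_uminus_real: "(SUP u\<in>A. - f u :: real) = - (INF u\<in>A. f u)"
  by (simp_all add: Inf_real_def image_image)

lemma eigval_uminus:
  assumes "k \<noteq> 0"
  shows "eigval K \<Omega> (\<lambda>x. - \<rho> x) k = - eigval K \<Omega> \<rho> (- k)"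
proof (cases "k > 0")
  case True
  then show ?thesis
    by (simp add: eigval_def INF_uminus_real SUP_uminus_real)
next
  case False
  with assms have "k < 0" by simp
  then show ?thesis
    by (simp add: eigval_def INF_uminus_real SUP_uminus_real)
qed

lemma eigval_exists_uminus: "eigval_exists \<Omega> (\<lambda>x. - \<rho> x) k \<longleftrightarrow> eigval_exists \<Omega> \<rho> (- k)"
  by (auto simp: eigval_exists_def)

lemma max_zero_eq_zero_iff: "max r 0 = 0 \<longleftrightarrow> r \<le> (0::real)"
  by (simp add: max_def)

lemma weights_uminus: "(\<lambda>x. - \<rho> x) \<in> weights \<Omega> \<longleftrightarrow> \<rho> \<in> weights \<Omega>"
proof -
  have "(\<lambda>x. - \<rho> x) \<in> borel_measurable (lebesgue_on \<Omega>) \<longleftrightarrow> \<rho> \<in> borel_measurable (lebesgue_on \<Omega>)"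
    using borel_measurable_uminus_eq by blast
  then show ?thesis by (auto simp: weights_def L_infinity_def)
qed

lemma eigenfunction_uminus: "eigenfunction K \<Omega> (\<lambda>x. - \<rho> x) (- l) u \<longleftrightarrow> eigenfunction K \<Omega> \<rho> l u"
  by (simp add: eigenfunction_def)

lemma singular_kernel_intro:
  fixes K :: "real^'n \<Rightarrow> real"
  assumes "bounded_lipschitz_domain \<Omega>" "admissible_kernel K"
  obtains \<alpha> s where "singular_kernel K \<Omega> \<alpha> s"
proof -
  obtain \<alpha> s where "\<alpha> > 0" "0 < s"
      "\<forall>x. x \<noteq> 0 \<longrightarrow> K x \<ge> \<alpha> * norm x powr (- (real CARD('n) + 2 * s))"
    using assms(2) unfolding admissible_kernel_def by blast
  then have "singular_kernel K \<Omega> \<alpha> s"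
    using assms(1) by unfold_locales (auto simp: bounded_lipschitz_domain_def)
  then show thesis by (rule that)
qed

text \<open>
  The weight is raised by \<open>\<epsilon>\<close> exactly on the zero set of the eigenfunction: this leaves the eigenvalue
  equation intact and changes the weight on a set of positive measure.
\<close>
lemma positive_eigenvalue_stable:
  fixes K :: "real^'n \<Rightarrow> real" and \<Omega> :: "(real^'n) set" and \<rho> :: "real^'n \<Rightarrow> real"
  assumes "bounded_lipschitz_domain \<Omega>" and "admissible_kernel K"
    and \<rho>: "\<rho> \<in> weights \<Omega>" and eig: "eigenfunction K \<Omega> \<rho> l u" and l: "l > 0"
    and Z: "{x \<in> \<Omega>. u x = 0} \<notin> null_sets lebesgue"
  obtains \<rho>' k where "\<rho>' \<in> weights \<Omega>" "AE x in lebesgue_on \<Omega>. \<rho> x \<le> \<rho>' x"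
    "\<not> (AE x in lebesgue_on \<Omega>. \<rho> x = \<rho>' x)" "k > 0"
    "eigval_exists \<Omega> \<rho> k" "eigval_exists \<Omega> \<rho>' k" "eigval K \<Omega> \<rho> k = eigval K \<Omega> \<rho>' k"
proof -
  obtain \<alpha> s where "singular_kernel K \<Omega> \<alpha> s" using singular_kernel_intro assms(1,2) .
  then interpret singular_kernel K \<Omega> \<alpha> s .
  have uX: "u \<in> X" and nz: "\<not> (AE x in lebesgue. u x = 0)"
    and weak: "\<And>v. v \<in> X \<Longrightarrow> E u v = l * weighted_form \<rho> u v"
    using eig by (auto simp: eigenfunction_def weighted_form_def)
  have \<rho>L: "\<rho> \<in> L_infinity \<Omega>" using \<rho> by (simp add: weights_def)
  have rad: "(1 / l) * E u v = weighted_form \<rho> u v" if "v \<in> X" for v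
    using weak[OF that] l by simp
  obtain k \<epsilon> where k: "k > 0" and \<epsilon>: "\<epsilon> > 0" and stable:
    "\<And>\<rho>'. \<rho>' \<in> L_infinity \<Omega> \<Longrightarrow> (AE x in lebesgue_on \<Omega>. \<rho> x \<le> \<rho>' x \<and> \<rho>' x \<le> \<rho> x + \<epsilon>) \<Longrightarrow>
        (\<And>v. v \<in> X \<Longrightarrow> weighted_form \<rho>' u v = weighted_form \<rho> u v) \<Longrightarrow> maxmin \<rho>' k = 1 / l"
    using maxmin_stable[OF \<rho>L _ uX nz rad] l by auto
  define \<rho>' where "\<rho>' x = \<rho> x + \<epsilon> * indicator {x. u x = 0} x" for x
  have [measurable]: "\<rho> \<in> borel_measurable (lebesgue_on \<Omega>)" "u \<in> borel_measurable (lebesgue_on \<Omega>)"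
    using \<rho>L X_measurable_domain[OF uX] by (auto simp: L_infinity_def)
  obtain C where C: "AE x in lebesgue_on \<Omega>. \<bar>\<rho> x\<bar> \<le> C"
    using \<rho>L by (auto simp: L_infinity_def)
  have le: "\<rho> x \<le> \<rho>' x" "\<rho>' x \<le> \<rho> x + \<epsilon>" for x
    using \<epsilon> by (auto simp: \<rho>'_def indicator_def)
  have "\<rho>' = (\<lambda>x. if u x = 0 then \<rho> x + \<epsilon> else \<rho> x)"
    by (auto simp: \<rho>'_def)
  also have "\<dots> \<in> borel_measurable (lebesgue_on \<Omega>)" by measurable
  finally have "\<rho>' \<in> borel_measurable (lebesgue_on \<Omega>)" .
  moreover have "AE x in lebesgue_on \<Omega>. \<bar>\<rho>' x\<bar> \<le> C + \<epsilon>"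
    using C by eventually_elim (use le in \<open>smt (verit)\<close>)
  ultimately have \<rho>'L: "\<rho>' \<in> L_infinity \<Omega>" by (auto simp: L_infinity_def)
  have "weighted_form \<rho>' u v = weighted_form \<rho> u v" for v
    unfolding weighted_form_def by (rule Bochner_Integration.integral_cong) (auto simp: \<rho>'_def indicator_def)
  then have "maxmin \<rho>' k = 1 / l" using le by (intro stable \<rho>'L) auto
  moreover have "maxmin \<rho> k = 1 / l" using \<epsilon> by (intro stable \<rho>L) auto
  ultimately have eq: "eigval K \<Omega> \<rho> (int k) = eigval K \<Omega> \<rho>' (int k)"
    using k by (simp add: eigval_eq_maxmin)
  have pos: "\<not> (AE x in lebesgue_on \<Omega>. \<rho> x \<le> 0)"
  proof
    assume "AE x in lebesgue_on \<Omega>. \<rho> x \<le> 0"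
    then have "weighted_form \<rho> u u \<le> weighted_form (\<lambda>_. 0) u u" by (rule weighted_form_mono_weight[OF \<rho>L L_infinity_zero uX])
    then have "l * weighted_form \<rho> u u \<le> 0" using l by (simp add: weighted_form_def mult_nonneg_nonpos)
    then show False using weak[OF uX] E_pos[OF uX nz] by simp
  qed
  have pos': "\<not> (AE x in lebesgue_on \<Omega>. \<rho>' x \<le> 0)"
  proof
    assume "AE x in lebesgue_on \<Omega>. \<rho>' x \<le> 0"
    then have "AE x in lebesgue_on \<Omega>. \<rho> x \<le> 0" by eventually_elim (use le order_trans in blast)
    with pos show False by simp
  qed
  have "eigval_exists \<Omega> \<rho> (int k)" "eigval_exists \<Omega> \<rho>' (int k)"
    using pos pos' k by (simp_all add: eigval_exists_def max_zero_eq_zero_iff)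
  moreover have "\<rho>' \<in> weights \<Omega>"
  proof -
    have "\<not> (AE x in lebesgue_on \<Omega>. \<rho>' x = 0)"
    proof
      assume "AE x in lebesgue_on \<Omega>. \<rho>' x = 0"
      then have "AE x in lebesgue_on \<Omega>. \<rho>' x \<le> 0" by eventually_elim simp
      with pos' show False by simp
    qed
    with \<rho>'L show ?thesis by (simp add: weights_def)
  qed
  moreover have "\<not> (AE x in lebesgue_on \<Omega>. \<rho> x = \<rho>' x)"
  proof
    assume "AE x in lebesgue_on \<Omega>. \<rho> x = \<rho>' x"
    then have "AE x in lebesgue. x \<in> \<Omega> \<longrightarrow> \<rho> x = \<rho>' x"
      by (subst (asm) AE_restrict_space_iff) auto
    then have "AE x in lebesgue. x \<notin> {x \<in> \<Omega>. u x = 0}"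
      by eventually_elim (use \<epsilon> in \<open>auto simp: \<rho>'_def\<close>)
    then have "{x \<in> \<Omega>. u x = 0} \<in> null_sets lebesgue"
      by (simp add: completion.null_sets_iff_AE)
    with Z show False by simp
  qed
  ultimately show thesis
    using that[of \<rho>' "int k"] eq le k by simp
qed

theorem theorem3p3:
  fixes K :: "real^'n \<Rightarrow> real" and \<Omega> :: "(real^'n) set" and \<rho> :: "real^'n \<Rightarrow> real"
  assumes "bounded_lipschitz_domain \<Omega>"
    and "admissible_kernel K"
    and "\<rho> \<in> weights \<Omega>"
    and "\<not> ucp K \<Omega> \<rho>"
  shows "\<exists>\<rho>'\<in>weights \<Omega>.
           ((AE x in lebesgue_on \<Omega>. \<rho> x \<le> \<rho>' x) \<or> (AE x in lebesgue_on \<Omega>. \<rho> x \<ge> \<rho>' x)) \<and>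
           \<not> (AE x in lebesgue_on \<Omega>. \<rho> x = \<rho>' x) \<and>
           (\<exists>k::int. k \<noteq> 0 \<and> eigval_exists \<Omega> \<rho> k \<and> eigval_exists \<Omega> \<rho>' k \<and>
              eigval K \<Omega> \<rho> k = eigval K \<Omega> \<rho>' k)"
proof -
  obtain l u where eig: "eigenfunction K \<Omega> \<rho> l u" and Z: "{x \<in> \<Omega>. u x = 0} \<notin> null_sets lebesgue"
    using assms(4) unfolding ucp_def by blast
  consider "l > 0" | "l = 0" | "l < 0" by linarith
  then show ?thesis
  proof cases
    case 1
    obtain \<rho>' k where "\<rho>' \<in> weights \<Omega>" "AE x in lebesgue_on \<Omega>. \<rho> x \<le> \<rho>' x"
      "\<not> (AE x in lebesgue_on \<Omega>. \<rho> x = \<rho>' x)" "k > 0"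
      "eigval_exists \<Omega> \<rho> k" "eigval_exists \<Omega> \<rho>' k" "eigval K \<Omega> \<rho> k = eigval K \<Omega> \<rho>' k"
      by (rule positive_eigenvalue_stable[OF assms(1-3) eig 1 Z])
    then show ?thesis
      by (intro bexI[of _ \<rho>'] conjI exI[of _ k]) auto
  next
    case 2
    obtain \<alpha> s where "singular_kernel K \<Omega> \<alpha> s" using singular_kernel_intro assms(1,2) .
    then interpret singular_kernel K \<Omega> \<alpha> s .
    have "u \<in> X" "\<not> (AE x in lebesgue. u x = 0)" "E u u = 0"
      using eig 2 by (auto simp: eigenfunction_def)
    then show ?thesis using E_pos[of u] by simp
  next
    case 3
    let ?\<sigma> = "\<lambda>x. - \<rho> x"
    have w: "?\<sigma> \<in> weights \<Omega>" using assms(3) by (simp add: weights_uminus)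
    have e: "eigenfunction K \<Omega> ?\<sigma> (- l) u" using eig by (simp add: eigenfunction_uminus)
    obtain \<sigma>' k where \<sigma>': "\<sigma>' \<in> weights \<Omega>" "AE x in lebesgue_on \<Omega>. ?\<sigma> x \<le> \<sigma>' x"
      "\<not> (AE x in lebesgue_on \<Omega>. ?\<sigma> x = \<sigma>' x)" "k > 0"
      "eigval_exists \<Omega> ?\<sigma> k" "eigval_exists \<Omega> \<sigma>' k" "eigval K \<Omega> ?\<sigma> k = eigval K \<Omega> \<sigma>' k"
      using positive_eigenvalue_stable[OF assms(1,2) w e _ Z] 3 by auto
    let ?\<rho>' = "\<lambda>x. - \<sigma>' x"
    have "?\<rho>' \<in> weights \<Omega>" using \<sigma>'(1) by (simp add: weights_uminus)
    moreover have "AE x in lebesgue_on \<Omega>. \<rho> x \<ge> ?\<rho>' x"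
      using \<sigma>'(2) by eventually_elim simp
    moreover have "\<not> (AE x in lebesgue_on \<Omega>. \<rho> x = ?\<rho>' x)"
    proof
      assume "AE x in lebesgue_on \<Omega>. \<rho> x = ?\<rho>' x"
      then have "AE x in lebesgue_on \<Omega>. ?\<sigma> x = \<sigma>' x" by eventually_elim simp
      with \<sigma>'(3) show False by simp
    qed
    moreover have "eigval_exists \<Omega> \<rho> (- k)" "eigval_exists \<Omega> ?\<rho>' (- k)"
      using \<sigma>'(5,6) by (simp_all add: eigval_exists_uminus)
    moreover have "eigval K \<Omega> \<rho> (- k) = eigval K \<Omega> ?\<rho>' (- k)"
      using \<sigma>'(4,7) eigval_uminus[of k K \<Omega> \<rho>] eigval_uminus[of "- k" K \<Omega> \<sigma>'] by simp
    moreover have "- k \<noteq> 0" using \<sigma>'(4) by simp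
    ultimately show ?thesis
      by (intro bexI[of _ ?\<rho>'] conjI disjI2 exI[of _ "- k"])
  qed
qed

end
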